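(* For every prime $p$ there exist finitely presented metabelian groups $\Gamma$ such that $\mathrm{vb}_1^{(p)}(\Gamma)$ is infinite.
   Context: For a finitely generated group $G$ and a prime $p$, the mod $p$ virtual first betti number is $\mathrm{vb}_1^{(p)}(G)=\sup\{\dim_{\mathbb{F}_p} H_1(S,\mathbb{F}_p)\mid S\le G \text{ a subgroup of finite index}\}\in\mathbb{N}\cup\{\infty\}$, where $\mathbb{F}_p$ is the field with $p$ elements. A group is metabelian if it has an abelian normal subgroup with abelian quotient. *)

theory Defs
  imports
    "HOL-Library.Extended_Nat"
    "HOL-Number_Theory.Residues"
    "Jordan_Normal_Form.Missing_VectorSpace"
begin

text \<open>Elements of the free group on \<open>S\<close> are reduced words. The letter \<open>(x, True)\<close> stands for
  the generator \<open>x\<close> and \<open>(x, False)\<close> for its inverse.\<close>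

fun inv_letter :: "'i \<times> bool \<Rightarrow> 'i \<times> bool" where
  "inv_letter (x, b) = (x, \<not> b)"

definition reduced_word :: "('i \<times> bool) list \<Rightarrow> bool" where
  "reduced_word w \<longleftrightarrow> successively (\<lambda>a b. b \<noteq> inv_letter a) w"

text \<open>\<open>push_letter a w\<close> is the reduced form of \<open>a # w\<close>, provided that \<open>w\<close> is reduced.\<close>

fun push_letter :: "'i \<times> bool \<Rightarrow> ('i \<times> bool) list \<Rightarrow> ('i \<times> bool) list" where
  "push_letter a [] = [a]"
| "push_letter a (b # w) = (if b = inv_letter a then w else a # b # w)"

definition free_group :: "'i set \<Rightarrow> ('i \<times> bool) list monoid" where
  "free_group S =
    \<lparr>carrier = {w. reduced_word w \<and> fst ` set w \<subseteq> S},
     monoid.mult = (\<lambda>u v. foldr push_letter u v),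
     one = []\<rparr>"

definition normal_closure :: "('a, 'm) monoid_scheme \<Rightarrow> 'a set \<Rightarrow> 'a set" where
  "normal_closure G R = \<Inter> {N. N \<lhd> G \<and> R \<subseteq> N}"

definition finitely_presented :: "('a, 'm) monoid_scheme \<Rightarrow> bool" where
  "finitely_presented G \<longleftrightarrow> group G \<and>
    (\<exists>(n :: nat) R. finite R \<and> R \<subseteq> carrier (free_group {..<n}) \<and>
       G \<cong> free_group {..<n} Mod normal_closure (free_group {..<n}) R)"

definition metabelian :: "('a, 'm) monoid_scheme \<Rightarrow> bool" where
  "metabelian G \<longleftrightarrow>
    (\<exists>N. N \<lhd> G \<and> comm_group (G\<lparr>carrier := N\<rparr>) \<and> comm_group (G Mod N))"

lemma inv_letter_inv_letter [simp]: "inv_letter (inv_letter a) = a"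
  by (cases a) simp

lemma fst_inv_letter [simp]: "fst (inv_letter a) = fst a"
  by (cases a) simp

lemma reduced_word_Nil [simp]: "reduced_word []"
  by (simp add: reduced_word_def)

lemma reduced_word_ConsD: "reduced_word (a # w) \<Longrightarrow> reduced_word w"
  by (cases w) (simp_all add: reduced_word_def)

lemma reduced_push_letter: "reduced_word w \<Longrightarrow> reduced_word (push_letter a w)"
  by (cases w) (auto simp: reduced_word_def dest: reduced_word_ConsD[unfolded reduced_word_def])

lemma reduced_foldr: "reduced_word v \<Longrightarrow> reduced_word (foldr push_letter u v)"
  by (induction u) (simp_all add: reduced_push_letter)

lemma foldr_push_letter_Nil: "reduced_word u \<Longrightarrow> foldr push_letter u [] = u"
proof (induction u)
  case (Cons a u)
  then show ?case
    by (cases u) (auto simp: reduced_word_def)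
qed simp

lemma push_letter_inv: "reduced_word w \<Longrightarrow> push_letter a (push_letter (inv_letter a) w) = w"
  by (cases w; cases "tl w") (auto simp: reduced_word_def)

lemma foldr_push_letter:
  assumes "reduced_word v" "reduced_word w"
  shows "foldr push_letter (push_letter a v) w = push_letter a (foldr push_letter v w)"
proof (cases v)
  case (Cons b v')
  then show ?thesis
    using push_letter_inv[of "foldr push_letter v' w" a] reduced_foldr[OF assms(2)] by simp
qed simp

lemma foldr_push_letter_assoc:
  assumes "reduced_word v" "reduced_word w"
  shows "foldr push_letter (foldr push_letter u v) w = foldr push_letter u (foldr push_letter v w)"
  by (induction u) (simp_all add: foldr_push_letter reduced_foldr assms)

lemma letters_push_letter: "fst ` set (push_letter a w) \<subseteq> insert (fst a) (fst ` set w)"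
  by (cases w) auto

lemma letters_foldr: "fst ` set (foldr push_letter u v) \<subseteq> fst ` set u \<union> fst ` set v"
proof (induction u)
  case (Cons a u)
  have "fst ` set (foldr push_letter (a # u) v) \<subseteq> insert (fst a) (fst ` set (foldr push_letter u v))"
    unfolding foldr.simps comp_apply by (rule letters_push_letter)
  also have "\<dots> \<subseteq> insert (fst a) (fst ` set u \<union> fst ` set v)"
    by (rule insert_mono[OF Cons.IH])
  finally show ?case
    by (simp only: list.set image_insert Un_insert_left)
qed simp

lemma reduced_inv_word: "reduced_word u \<Longrightarrow> reduced_word (rev (map inv_letter u))"
  unfolding reduced_word_def successively_rev successively_map
  by (erule successively_mono) (metis inv_letter_inv_letter)

lemma foldr_inv_word:
  "reduced_word v \<Longrightarrow> foldr push_letter (rev (map inv_letter u)) (foldr push_letter u v) = v"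
proof (induction u arbitrary: v)
  case (Cons a u)
  have "push_letter (inv_letter a) (push_letter a (foldr push_letter u v)) = foldr push_letter u v"
    using push_letter_inv[of "foldr push_letter u v" "inv_letter a"] reduced_foldr[OF Cons.prems]
    by simp
  then show ?case
    using Cons by simp
qed simp

lemma group_free_group: "group (free_group S)"
proof (rule groupI)
  fix u v assume uv: "u \<in> carrier (free_group S)" "v \<in> carrier (free_group S)"
  then have "fst ` set u \<union> fst ` set v \<subseteq> S"
    by (simp add: free_group_def)
  then have "fst ` set (foldr push_letter u v) \<subseteq> S"
    by (rule order_trans[OF letters_foldr])
  with uv show "u \<otimes>\<^bsub>free_group S\<^esub> v \<in> carrier (free_group S)"
    by (simp add: free_group_def reduced_foldr)
next
  fix u assume u: "u \<in> carrier (free_group S)"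
  show "\<exists>v \<in> carrier (free_group S). v \<otimes>\<^bsub>free_group S\<^esub> u = \<one>\<^bsub>free_group S\<^esub>"
  proof
    show "rev (map inv_letter u) \<in> carrier (free_group S)"
      using u by (auto simp: free_group_def reduced_inv_word)
    show "rev (map inv_letter u) \<otimes>\<^bsub>free_group S\<^esub> u = \<one>\<^bsub>free_group S\<^esub>"
      using u foldr_inv_word[of "[]" u] by (simp add: free_group_def foldr_push_letter_Nil)
  qed
qed (auto simp: free_group_def foldr_push_letter_assoc)

text \<open>\<open>bar_chains R G n\<close> is the free \<open>R\<close>-module on \<open>n\<close>-tuples of elements of \<open>G\<close>, the degree \<open>n\<close> part
  of the inhomogeneous bar complex with trivial coefficients \<open>R\<close>. Chains are finitely supported
  functions on lists. The fields \<open>mult\<close> and \<open>one\<close> of a module record carry no meaning.\<close>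

definition bar_chains ::
  "('r, 's) ring_scheme \<Rightarrow> ('a, 'm) monoid_scheme \<Rightarrow> nat \<Rightarrow> ('r, 'a list \<Rightarrow> 'r) module" where
  "bar_chains R G n =
    \<lparr>carrier = {c. (\<forall>gs. c gs \<in> carrier R) \<and> finite {gs. c gs \<noteq> \<zero>\<^bsub>R\<^esub>} \<and>
                   (\<forall>gs. c gs \<noteq> \<zero>\<^bsub>R\<^esub> \<longrightarrow> length gs = n \<and> set gs \<subseteq> carrier G)},
     monoid.mult = (\<lambda>_ _ _. \<zero>\<^bsub>R\<^esub>),
     one = (\<lambda>_. \<zero>\<^bsub>R\<^esub>),
     zero = (\<lambda>_. \<zero>\<^bsub>R\<^esub>),
     add = (\<lambda>c d gs. c gs \<oplus>\<^bsub>R\<^esub> d gs),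
     smult = (\<lambda>r c gs. r \<otimes>\<^bsub>R\<^esub> c gs)\<rparr>"

definition bar_face :: "('a, 'm) monoid_scheme \<Rightarrow> 'a list \<Rightarrow> nat \<Rightarrow> 'a list" where
  "bar_face G gs i =
    (if i = 0 then tl gs
     else if i = length gs then butlast gs
     else take (i - 1) gs @ [gs ! (i - 1) \<otimes>\<^bsub>G\<^esub> gs ! i] @ drop (i + 1) gs)"

text \<open>The linear extension of
  \<open>\<partial>[g\<^sub>1|\<dots>|g\<^sub>n] = [g\<^sub>2|\<dots>|g\<^sub>n] + (\<Sum>0<i<n. (-1)\<^sup>i [g\<^sub>1|\<dots>|g\<^sub>i g\<^sub>i\<^sub>+\<^sub>1|\<dots>|g\<^sub>n]) + (-1)\<^sup>n [g\<^sub>1|\<dots>|g\<^sub>n\<^sub>-\<^sub>1]\<close>.\<close>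

definition bar_boundary ::
  "('r, 's) ring_scheme \<Rightarrow> ('a, 'm) monoid_scheme \<Rightarrow> nat \<Rightarrow> ('a list \<Rightarrow> 'r) \<Rightarrow> 'a list \<Rightarrow> 'r" where
  "bar_boundary R G n c hs =
    (if n = 0 then \<zero>\<^bsub>R\<^esub>
     else \<Oplus>\<^bsub>R\<^esub>gs\<in>{gs. c gs \<noteq> \<zero>\<^bsub>R\<^esub>}. \<Oplus>\<^bsub>R\<^esub>i\<in>{i. i \<le> n \<and> bar_face G gs i = hs}.
       ((\<ominus>\<^bsub>R\<^esub> \<one>\<^bsub>R\<^esub>) [^]\<^bsub>R\<^esub> i) \<otimes>\<^bsub>R\<^esub> c gs)"

definition bar_cycles ::
  "('r, 's) ring_scheme \<Rightarrow> ('a, 'm) monoid_scheme \<Rightarrow> nat \<Rightarrow> ('a list \<Rightarrow> 'r) set" where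
  "bar_cycles R G n =
    {c \<in> carrier (bar_chains R G n). bar_boundary R G n c = (\<lambda>_. \<zero>\<^bsub>R\<^esub>)}"

definition bar_boundaries ::
  "('r, 's) ring_scheme \<Rightarrow> ('a, 'm) monoid_scheme \<Rightarrow> nat \<Rightarrow> ('a list \<Rightarrow> 'r) set" where
  "bar_boundaries R G n =
    bar_boundary R G (Suc n) ` carrier (bar_chains R G (Suc n))"

definition quotient_module ::
  "('r, 'b, 'm) module_scheme \<Rightarrow> 'b set \<Rightarrow> ('r, 'b set) module" where
  "quotient_module M N =
    \<lparr>carrier = a_rcosets\<^bsub>M\<^esub> N,
     monoid.mult = (\<lambda>_ _. N),
     one = N,
     zero = N,
     add = (\<lambda>A B. A <+>\<^bsub>M\<^esub> B),
     smult = (\<lambda>r A. \<Union>x\<in>A. N +>\<^bsub>M\<^esub> (r \<odot>\<^bsub>M\<^esub> x))\<rparr>"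

definition group_homology ::
  "('r, 's) ring_scheme \<Rightarrow> ('a, 'm) monoid_scheme \<Rightarrow> nat \<Rightarrow> ('r, ('a list \<Rightarrow> 'r) set) module" where
  "group_homology R G n =
    quotient_module ((bar_chains R G n)\<lparr>carrier := bar_cycles R G n\<rparr>) (bar_boundaries R G n)"

text \<open>\<open>vectorspace.dim\<close> is a natural number, meaningful only in the finite-dimensional case.\<close>

definition vs_dim :: "('r, 's) ring_scheme \<Rightarrow> ('r, 'b, 'm) module_scheme \<Rightarrow> enat" where
  "vs_dim K V = (if vectorspace.fin_dim K V then enat (vectorspace.dim K V) else \<infinity>)"

abbreviation prime_field :: "nat \<Rightarrow> int ring" where
  "prime_field p \<equiv> residue_ring (int p)"

definition virtual_betti1 :: "nat \<Rightarrow> ('a, 'm) monoid_scheme \<Rightarrow> enat" where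
  "virtual_betti1 p G =
    (SUP S \<in> {S. subgroup S G \<and> finite (rcosets\<^bsub>G\<^esub> S)}.
       vs_dim (prime_field p) (group_homology (prime_field p) (G\<lparr>carrier := S\<rparr>) 1))"

end

theory Submission
  imports Defs "HOL-Algebra.Weak_Morphisms" "HOL-Algebra.Bij"
begin

text \<open>
  The group is given by generators \<open>a\<close>, \<open>s\<close>, \<open>t\<close>, the relations that \<open>s\<close> commutes with \<open>t\<close> and that
  \<open>a\<close> commutes with \<open>s a s\<^sup>-\<^sup>1\<close> and with \<open>s\<^sup>2 a s\<^sup>-\<^sup>2\<close>, and the relation
  \<open>t a t\<^sup>-\<^sup>1 = a (s a s\<^sup>-\<^sup>1)\<^sup>-\<^sup>1 (s\<^sup>2 a s\<^sup>-\<^sup>2)\<close>. It is the same group for all primes. It varies an example of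
  Baumslag: the normal closure of \<open>a\<close> is a module over the group ring of the free abelian group on
  \<open>s\<close> and \<open>t\<close>, in which \<open>t\<close> acts as \<open>1 - s + s\<^sup>2\<close>.

  Finitely many relations suffice for this because of the relation with \<open>t\<close>. Write
  \<open>b i = s\<^sup>i a s\<^sup>-\<^sup>i\<close>. Conjugating the relation that \<open>b 0\<close> commutes with \<open>b (n - 2)\<close> by \<open>t\<close> gives one in
  which \<open>b 0\<close> and \<open>b n\<close> are the only two conjugates at distance \<open>n\<close>, and so, by induction, all \<open>b i\<close>
  commute (lemma \<open>a_centralizes_b_nat\<close>). They generate an abelian group \<open>B\<close> with
  \<open>t B t\<^sup>-\<^sup>1 \<subseteq> B\<close>; the ascending union of the groups \<open>t\<^sup>-\<^sup>n B t\<^sup>n\<close> is an abelian normal subgroup, and the quotient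
  by it is generated by the commuting images of \<open>s\<close> and \<open>t\<close>.

  For the homology, let \<open>x = 1 + \<epsilon>\<close> in \<open>V = F\<^sub>p[\<epsilon>]/(\<epsilon>\<^sup>k)\<close>. The elements \<open>x\<close> and \<open>1 - x + x\<^sup>2 = 1 + \<epsilon> + \<epsilon>\<^sup>2\<close>
  are units, for every \<open>p\<close>. So the group acts on the finite set \<open>V\<close> by affine maps, where
  \<open>a\<close> is the translation by \<open>1\<close> and \<open>s\<close> and \<open>t\<close> are the multiplications by these two units. The elements that
  act as translations form a subgroup \<open>S\<close> of finite index, and the coordinates of the translation
  vector are \<open>k\<close> homomorphisms from \<open>S\<close> to \<open>F\<^sub>p\<close>. On the elements \<open>b 0, \<dots>, b (k - 1)\<close> of \<open>S\<close>, which translate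
  by \<open>1, x, \<dots>, x\<^bsup>k - 1\<^esup>\<close>, they take the values of a unitriangular matrix. A homomorphism from \<open>S\<close> to \<open>F\<^sub>p\<close>
  defines a linear functional on \<open>H\<^sub>1(S, F\<^sub>p)\<close>, so the classes of these elements are linearly independent
  and the dimension is at least \<open>k\<close> (lemma \<open>vs_dim_H1_ge\<close>).
\<close>

section \<open>Conjugation and centralizers\<close>

context group
begin

definition conjugate :: "'a \<Rightarrow> 'a \<Rightarrow> 'a" where
  "conjugate g x = g \<otimes> x \<otimes> inv g"

lemma conjugate_closed [simp]: "g \<in> carrier G \<Longrightarrow> x \<in> carrier G \<Longrightarrow> conjugate g x \<in> carrier G"
  by (simp add: conjugate_def)

lemma conjugate_mult:
  "\<lbrakk>g \<in> carrier G; x \<in> carrier G; y \<in> carrier G\<rbrakk> \<Longrightarrow> conjugate g (x \<otimes> y) = conjugate g x \<otimes> conjugate g y"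
  by (simp add: conjugate_def m_assoc inv_solve_left)

lemma conjugate_one [simp]: "g \<in> carrier G \<Longrightarrow> conjugate g \<one> = \<one>"
  by (simp add: conjugate_def)

lemma conjugate_by_one [simp]: "x \<in> carrier G \<Longrightarrow> conjugate \<one> x = x"
  by (simp add: conjugate_def)

lemma conjugate_inv: "\<lbrakk>g \<in> carrier G; x \<in> carrier G\<rbrakk> \<Longrightarrow> conjugate g (inv x) = inv (conjugate g x)"
  by (simp add: conjugate_def inv_mult_group m_assoc)

lemma conjugate_conjugate:
  "\<lbrakk>g \<in> carrier G; h \<in> carrier G; x \<in> carrier G\<rbrakk> \<Longrightarrow> conjugate g (conjugate h x) = conjugate (g \<otimes> h) x"
  by (simp add: conjugate_def inv_mult_group m_assoc)

lemma conjugate_commute: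
  assumes "g \<in> carrier G" "h \<in> carrier G" "x \<in> carrier G" "g \<otimes> h = h \<otimes> g"
  shows "conjugate g (conjugate h x) = conjugate h (conjugate g x)"
  using assms by (simp add: conjugate_conjugate)

text \<open>The centralizer of a single element. Commuting with \<open>y\<close> is expressed by membership in
  \<open>centralizer y\<close>, so that products and inverses are handled by the subgroup property.\<close>

definition centralizer :: "'a \<Rightarrow> 'a set" where
  "centralizer y = {x \<in> carrier G. x \<otimes> y = y \<otimes> x}"

lemma subgroup_centralizer:
  assumes y: "y \<in> carrier G"
  shows "subgroup (centralizer y) G"
proof (rule subgroupI)
  show "centralizer y \<noteq> {}"
    using y by (auto simp: centralizer_def)
next
  fix x assume x: "x \<in> centralizer y"
  then have xG: "x \<in> carrier G" and xy: "x \<otimes> y = y \<otimes> x"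
    by (auto simp: centralizer_def)
  have "inv x \<otimes> y = inv x \<otimes> (y \<otimes> x) \<otimes> inv x"
    using xG y by (simp add: m_assoc)
  also have "\<dots> = y \<otimes> inv x"
    using xG y by (simp add: xy[symmetric] m_assoc[symmetric])
  finally show "inv x \<in> centralizer y"
    using xG by (simp add: centralizer_def)
next
  fix x z assume "x \<in> centralizer y" "z \<in> centralizer y"
  then have xz: "x \<in> carrier G" "z \<in> carrier G"
    and xy: "x \<otimes> y = y \<otimes> x" and zy: "z \<otimes> y = y \<otimes> z"
    by (auto simp: centralizer_def)
  have "x \<otimes> z \<otimes> y = x \<otimes> y \<otimes> z"
    using xz y by (simp only: m_assoc zy)
  also have "\<dots> = y \<otimes> (x \<otimes> z)"
    using xz y by (simp only: m_assoc xy)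
  finally show "x \<otimes> z \<in> centralizer y"
    using xz by (simp add: centralizer_def)
qed (auto simp: centralizer_def)

lemma centralizer_sym: "x \<in> centralizer y \<Longrightarrow> y \<in> carrier G \<Longrightarrow> y \<in> centralizer x"
  by (simp add: centralizer_def)

lemma centralizer_conjugate:
  assumes "g \<in> carrier G" "y \<in> carrier G" "x \<in> centralizer y"
  shows "conjugate g x \<in> centralizer (conjugate g y)"
  using assms by (auto simp: centralizer_def conjugate_mult[symmetric])

lemma generate_commute:
  assumes X: "X \<subseteq> carrier G" and comm: "\<And>x y. x \<in> X \<Longrightarrow> y \<in> X \<Longrightarrow> x \<otimes> y = y \<otimes> x"
    and "x \<in> generate G X" "y \<in> generate G X"
  shows "x \<otimes> y = y \<otimes> x"
proof -
  have *: "generate G X \<subseteq> centralizer y" if "y \<in> carrier G" "X \<subseteq> centralizer y" for y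
    using that by (intro generate_subgroup_incl subgroup_centralizer)
  have "X \<subseteq> centralizer y" if "y \<in> X" for y
    using that X comm by (auto simp: centralizer_def)
  then have "generate G X \<subseteq> centralizer y" if "y \<in> X" for y
    using that X * by blast
  then have "X \<subseteq> centralizer x"
    using X assms(3) centralizer_sym by blast
  then have "generate G X \<subseteq> centralizer x"
    using assms(3) X by (intro *) (auto intro: generate_in_carrier)
  then show ?thesis
    using assms(4) by (auto simp: centralizer_def)
qed

lemma conjugate_generate:
  assumes g: "g \<in> carrier G" and X: "X \<subseteq> carrier G"
    and conjugate: "\<And>x. x \<in> X \<Longrightarrow> conjugate g x \<in> generate G X" and y: "y \<in> generate G X"
  shows "conjugate g y \<in> generate G X"
  using y
proof (induction rule: generate.induct)
  case (inv h)
  then show ?case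
    using g X conjugate conjugate_inv[of g h] generate_m_inv_closed[OF X] by auto
next
  case (eng h1 h2)
  moreover have "h1 \<in> carrier G" "h2 \<in> carrier G"
    using eng.hyps X by (auto intro: generate_in_carrier)
  ultimately show ?case
    using g by (simp add: conjugate_mult generate.eng)
qed (use g conjugate in \<open>auto intro: generate.one\<close>)

lemma comm_group_quotient_if_generators_commute:
  assumes N: "N \<lhd> G" and X: "X \<subseteq> carrier G" "generate G X = carrier G"
    and comm: "\<And>x y. x \<in> X \<Longrightarrow> y \<in> X \<Longrightarrow> N #> (x \<otimes> y) = N #> (y \<otimes> x)"
  shows "comm_group (G Mod N)"
proof -
  interpret N: normal N G by (rule N)
  interpret Q: group "G Mod N" by (rule N.factorgroup_is_group)
  interpret \<pi>: group_hom G "G Mod N" "\<lambda>x. N #> x"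
    by unfold_locales (rule N.r_coset_hom_Mod)
  have car: "carrier (G Mod N) = generate (G Mod N) ((\<lambda>x. N #> x) ` X)"
    using \<pi>.generate_img[OF X(1)] X(2) by (auto simp: FactGroup_def RCOSETS_def)
  have X': "(\<lambda>x. N #> x) ` X \<subseteq> carrier (G Mod N)"
    using X(1) by (auto simp: FactGroup_def RCOSETS_def)
  show ?thesis
  proof (rule Q.group_comm_groupI)
    fix x y assume "x \<in> carrier (G Mod N)" "y \<in> carrier (G Mod N)"
    moreover have "u \<otimes>\<^bsub>G Mod N\<^esub> v = v \<otimes>\<^bsub>G Mod N\<^esub> u"
      if "u \<in> (\<lambda>x. N #> x) ` X" "v \<in> (\<lambda>x. N #> x) ` X" for u v
      using that comm X(1) by (auto simp: \<pi>.hom_mult[symmetric] subset_iff)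
    ultimately show "x \<otimes>\<^bsub>G Mod N\<^esub> y = y \<otimes>\<^bsub>G Mod N\<^esub> x"
      unfolding car by (rule Q.generate_commute[OF X', rotated -2])
  qed
qed

end

section \<open>Groups satisfying the relations are metabelian\<close>

text \<open>The four defining relations, as pairs of a left and a right hand side. They hold in \<open>G\<close> for the
  elements \<open>a\<close>, \<open>s\<close>, \<open>t\<close> if and only if the set is contained in the diagonal \<open>Id\<close>.\<close>

definition baumslag_relations :: "('a, 'm) monoid_scheme \<Rightarrow> 'a \<Rightarrow> 'a \<Rightarrow> 'a \<Rightarrow> ('a \<times> 'a) set" where
  "baumslag_relations G a s t =
    {(s \<otimes>\<^bsub>G\<^esub> t, t \<otimes>\<^bsub>G\<^esub> s),
     (a \<otimes>\<^bsub>G\<^esub> group.conjugate G s a, group.conjugate G s a \<otimes>\<^bsub>G\<^esub> a),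
     (a \<otimes>\<^bsub>G\<^esub> group.conjugate G (s \<otimes>\<^bsub>G\<^esub> s) a, group.conjugate G (s \<otimes>\<^bsub>G\<^esub> s) a \<otimes>\<^bsub>G\<^esub> a),
     (group.conjugate G t a, a \<otimes>\<^bsub>G\<^esub> inv\<^bsub>G\<^esub> group.conjugate G s a \<otimes>\<^bsub>G\<^esub> group.conjugate G (s \<otimes>\<^bsub>G\<^esub> s) a)}"

lemma (in group) baumslag_relations_closed:
  "\<lbrakk>a \<in> carrier G; s \<in> carrier G; t \<in> carrier G; (l, r) \<in> baumslag_relations G a s t\<rbrakk> \<Longrightarrow>
    l \<in> carrier G \<and> r \<in> carrier G"
  by (auto simp: baumslag_relations_def)

lemma (in group_hom) hom_conjugate:
  "\<lbrakk>g \<in> carrier G; x \<in> carrier G\<rbrakk> \<Longrightarrow> h (group.conjugate G g x) = group.conjugate H (h g) (h x)"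
  by (simp add: G.conjugate_def H.conjugate_def)

lemma (in group_hom) hom_baumslag_relations:
  "\<lbrakk>a \<in> carrier G; s \<in> carrier G; t \<in> carrier G\<rbrakk> \<Longrightarrow>
    baumslag_relations H (h a) (h s) (h t) = map_prod h h ` baumslag_relations G a s t"
  by (simp add: baumslag_relations_def hom_conjugate)

text \<open>A group generated by three elements that satisfy the relations. Nothing else is assumed: the
  group may be any quotient of the presented one.\<close>

locale baumslag_generators = group +
  fixes a s t
  assumes a [simp]: "a \<in> carrier G" and s [simp]: "s \<in> carrier G" and t [simp]: "t \<in> carrier G"
    and generate: "generate G {a, s, t} = carrier G"
    and relations: "baumslag_relations G a s t \<subseteq> Id"
begin

lemma st: "s \<otimes> t = t \<otimes> s"
  and comm1: "a \<in> centralizer (conjugate s a)"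
  and comm2: "a \<in> centralizer (conjugate (s \<otimes> s) a)"
  and conjugate_t_a: "conjugate t a = a \<otimes> inv (conjugate s a) \<otimes> conjugate (s \<otimes> s) a"
  using relations by (simp_all add: baumslag_relations_def centralizer_def)

text \<open>The conjugates of \<open>a\<close> by the powers of \<open>s\<close>.\<close>

definition b :: "int \<Rightarrow> 'a" where
  "b i = conjugate (s [^] i) a"

lemma b_closed [simp]: "b i \<in> carrier G"
  by (simp add: b_def)

lemma b_0: "b 0 = a" and b_1: "b 1 = conjugate s a" and b_2: "b 2 = conjugate (s \<otimes> s) a"
  using int_pow_mult[of s 1 1] by (simp_all add: b_def int_pow_1)

lemma conjugate_s_pow_b: "conjugate (s [^] (i::int)) (b j) = b (i + j)"
  by (simp add: b_def conjugate_conjugate int_pow_mult)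

lemma t_s_pow: "t \<otimes> s [^] (i::int) = s [^] i \<otimes> t"
proof -
  have "s \<in> centralizer t"
    using st by (simp add: centralizer_def)
  then have "s [^] i \<in> centralizer t"
    by (rule subgroup_int_pow_closed[OF subgroup_centralizer[OF t]])
  then show ?thesis
    by (simp add: centralizer_def)
qed

lemma conjugate_t_b: "conjugate t (b i) = b i \<otimes> inv (b (i + 1)) \<otimes> b (i + 2)"
proof -
  have "conjugate t (b i) = conjugate (s [^] i) (conjugate t a)"
    unfolding b_def using t_s_pow by (intro conjugate_commute) auto
  also have "conjugate t a = b 0 \<otimes> inv (b 1) \<otimes> b 2"
    by (simp add: conjugate_t_a b_0 b_1 b_2)
  finally show ?thesis
    by (simp add: conjugate_mult conjugate_inv conjugate_s_pow_b)
qed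

lemma b_centralizes_shift: "a \<in> centralizer (b (j - i)) \<Longrightarrow> b i \<in> centralizer (b j)"
  using centralizer_conjugate[of "s [^] i" "b (j - i)" a] by (simp add: conjugate_s_pow_b b_def[of i])

lemma a_centralizes_neg: "a \<in> centralizer (b i) \<Longrightarrow> a \<in> centralizer (b (- i))"
  using b_centralizes_shift[of 0 "- i"] centralizer_sym[of "b (-i)" a] by (simp add: b_0)

text \<open>The inductive step conjugates the relation between \<open>a\<close> and \<open>b (n - 2)\<close> by \<open>t\<close>. In the
  resulting relation the only pair of conjugates at distance \<open>n\<close> is \<open>a\<close>, \<open>b n\<close>, and all
  other pairs are closer.\<close>

lemma a_centralizes_b_nat: "a \<in> centralizer (b (int n))"
proof (induction n rule: less_induct)
  case (less n)
  have close: "b i \<in> centralizer (b j)" if "\<bar>j - i\<bar> < int n" for i j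
  proof -
    have "a \<in> centralizer (b \<bar>j - i\<bar>)"
      using less[of "nat \<bar>j - i\<bar>"] that by simp
    then show ?thesis
      using a_centralizes_neg[of "i - j"] by (intro b_centralizes_shift) (auto simp: abs_if split: if_splits)
  qed
  consider "n = 0" | "n = 1" | "n = 2" | "n \<ge> 3"
    by linarith
  then show ?case
  proof cases
    case 4
    let ?n = "int n"
    let ?g = "b (?n - 2) \<otimes> inv (b (?n - 1)) \<otimes> b ?n"
    let ?w = "inv (b 1) \<otimes> b 2"
    \<comment> \<open>\<open>?g\<close> is the conjugate of \<open>b (n - 2)\<close> by \<open>t\<close>, and \<open>a \<otimes> ?w\<close> is the conjugate of \<open>a\<close>.\<close>
    interpret Cg: subgroup "centralizer ?g" G
      by (rule subgroup_centralizer) simp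
    have "?g \<in> centralizer (b i)" if "i \<in> {1, 2}" for i
    proof -
      interpret C: subgroup "centralizer (b i)" G
        by (rule subgroup_centralizer) simp
      show ?thesis
        using 4 that by (intro C.m_closed C.m_inv_closed close) auto
    qed
    then have w: "?w \<in> centralizer ?g"
      by (intro Cg.m_closed Cg.m_inv_closed; rule centralizer_sym) auto
    \<comment> \<open>This is the relation that is conjugated by \<open>t\<close>. It is known because \<open>n - 2\<close> lies between \<open>1\<close> and \<open>n - 1\<close>.\<close>
    have "b 0 \<in> centralizer (b (?n - 2))"
      using 4 by (intro close) auto
    then have "conjugate t (b 0) \<in> centralizer (conjugate t (b (?n - 2)))"
      by (intro centralizer_conjugate) auto
    then have "b 0 \<otimes> ?w \<in> centralizer ?g"
      unfolding conjugate_t_b by (simp add: m_assoc)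
    then have "b 0 \<otimes> ?w \<otimes> inv ?w \<in> centralizer ?g"
      using w by blast
    then have "a \<in> centralizer ?g"
      by (simp add: m_assoc b_0)
    then have ga: "?g \<in> centralizer a"
      by (rule centralizer_sym) simp
    interpret Ca: subgroup "centralizer a" G
      by (rule subgroup_centralizer) simp
    let ?h = "b (?n - 2) \<otimes> inv (b (?n - 1))"
    have h: "?h \<in> centralizer (b 0)"
      unfolding b_0 using 4 by (intro Ca.m_closed Ca.m_inv_closed close[of 0, unfolded b_0]) auto
    then have "inv ?h \<in> centralizer a"
      unfolding b_0 by (rule Ca.m_inv_closed)
    then have "inv ?h \<otimes> ?g \<in> centralizer a"
      using ga by (rule Ca.m_closed)
    also have "inv ?h \<otimes> ?g = b ?n"
      by (subst inv_solve_left') simp_all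
    finally show ?thesis
      by (rule centralizer_sym) simp
  qed (use comm1 comm2 in \<open>auto simp: b_0 b_1 b_2 centralizer_def\<close>)
qed

lemma b_commute: "b i \<otimes> b j = b j \<otimes> b i"
proof -
  have "a \<in> centralizer (b (int (nat \<bar>j - i\<bar>)))"
    by (rule a_centralizes_b_nat)
  then have "a \<in> centralizer (b (j - i))"
    using a_centralizes_neg[of "i - j"] by (cases "j \<ge> i") auto
  then have "b i \<in> centralizer (b j)"
    by (rule b_centralizes_shift)
  then show ?thesis
    by (simp add: centralizer_def)
qed

text \<open>The subgroup generated by the conjugates of \<open>a\<close> under powers of \<open>s\<close>, and the union of its
  conjugates under negative powers of \<open>t\<close>. The union is ascending because \<open>t\<close> conjugates \<open>B\<close> into itself;
  it is the normal closure of \<open>a\<close>.\<close>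

definition B :: "'a set" where
  "B = generate G (range b)"

definition A :: "'a set" where
  "A = {x \<in> carrier G. \<exists>n::nat. conjugate (t [^] n) x \<in> B}"

sublocale B: subgroup B G
  unfolding B_def by (rule generate_is_subgroup) auto

lemma B_commute: "x \<in> B \<Longrightarrow> y \<in> B \<Longrightarrow> x \<otimes> y = y \<otimes> x"
  unfolding B_def by (rule generate_commute[of "range b"]) (auto simp: b_commute)

lemma b_in_B: "b i \<in> B"
  unfolding B_def by (rule generate.incl) simp

lemma conjugate_s_pow_B: "x \<in> B \<Longrightarrow> conjugate (s [^] (i::int)) x \<in> B"
  unfolding B_def
  by (rule conjugate_generate) (auto simp: conjugate_s_pow_b intro: generate.incl)

lemma conjugate_t_B:
  assumes x: "x \<in> B"
  shows "conjugate t x \<in> B"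
proof -
  have "conjugate t (b i) \<in> B" for i
    unfolding conjugate_t_b by (intro B.m_closed B.m_inv_closed b_in_B)
  then show ?thesis
    unfolding B_def by (intro conjugate_generate[OF t _ _ x[unfolded B_def]]) auto
qed

lemma conjugate_t_pow_B: "x \<in> B \<Longrightarrow> conjugate (t [^] (n::nat)) x \<in> B"
proof (induction n)
  case (Suc n)
  then show ?case
    using conjugate_t_B[of "conjugate (t [^] n) x"] nat_pow_Suc2[OF t, of n] by (simp add: conjugate_conjugate)
qed simp

lemma conjugate_t_pow_mono:
  assumes "x \<in> carrier G" "conjugate (t [^] n) x \<in> B" "n \<le> (m::nat)"
  shows "conjugate (t [^] m) x \<in> B"
proof -
  have "conjugate (t [^] m) x = conjugate (t [^] (m - n)) (conjugate (t [^] n) x)"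
    using assms by (simp add: conjugate_conjugate nat_pow_mult)
  then show ?thesis
    using assms conjugate_t_pow_B by simp
qed

lemma mem_A_if: "conjugate (t [^] (n::nat)) x \<in> B \<Longrightarrow> x \<in> carrier G \<Longrightarrow> x \<in> A"
  by (auto simp: A_def)

lemma A_common_power:
  assumes "x \<in> A" "y \<in> A"
  obtains n :: nat where "conjugate (t [^] n) x \<in> B" "conjugate (t [^] n) y \<in> B"
proof -
  obtain m n :: nat where "conjugate (t [^] m) x \<in> B" "conjugate (t [^] n) y \<in> B"
    using assms by (auto simp: A_def)
  then show thesis
    using that[of "max m n"] conjugate_t_pow_mono[of x m "max m n"] conjugate_t_pow_mono[of y n "max m n"] assms
    by (auto simp: A_def)
qed

lemma A_carrier: "x \<in> A \<Longrightarrow> x \<in> carrier G"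
  by (simp add: A_def)

lemma B_subset_A: "x \<in> B \<Longrightarrow> x \<in> A"
  unfolding A_def using B.mem_carrier by (auto intro!: exI[of _ "0::nat"])

lemma subgroup_A: "subgroup A G"
proof (rule subgroupI)
  show "A \<noteq> {}"
    using B_subset_A[OF B.one_closed] by blast
next
  fix x assume "x \<in> A"
  then show "inv x \<in> A"
    by (auto simp: A_def conjugate_inv)
next
  fix x y assume xy: "x \<in> A" "y \<in> A"
  then obtain n :: nat where "conjugate (t [^] n) x \<in> B" "conjugate (t [^] n) y \<in> B"
    by (rule A_common_power)
  then show "x \<otimes> y \<in> A"
    using xy[THEN A_carrier] by (auto simp: A_def conjugate_mult)
qed (auto simp: A_def)

lemma A_commute:
  assumes xy: "x \<in> A" "y \<in> A"
  shows "x \<otimes> y = y \<otimes> x"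
proof -
  obtain n :: nat where n: "conjugate (t [^] n) x \<in> B" "conjugate (t [^] n) y \<in> B"
    using xy by (rule A_common_power)
  have "conjugate (t [^] n) (x \<otimes> y) = conjugate (t [^] n) (y \<otimes> x)"
    using xy[THEN A_carrier] B_commute[OF n] by (simp add: conjugate_mult)
  then show ?thesis
    using xy[THEN A_carrier] by (simp add: conjugate_def)
qed

lemma conjugate_A_generators:
  assumes x: "x \<in> A" and g: "g \<in> {a, s, t} \<union> m_inv G ` {a, s, t}"
  shows "conjugate g x \<in> A"
proof -
  obtain n :: nat where xG: "x \<in> carrier G" and n: "conjugate (t [^] n) x \<in> B"
    using x by (auto simp: A_def)
  interpret A: subgroup A G
    by (rule subgroup_A)
  have "a \<in> A"
    using B_subset_A[OF b_in_B[of 0]] by (simp add: b_0)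
  then have conjugate_a: "conjugate a x \<in> A" "conjugate (inv a) x \<in> A"
    using x by (simp_all add: conjugate_def)
  have conjugate_s_pow: "conjugate (s [^] i) x \<in> A" for i :: int
  proof (rule mem_A_if)
    have "t [^] n \<otimes> s [^] i = s [^] i \<otimes> t [^] n"
      using subgroup_int_pow_closed[OF subgroup_centralizer, of "s [^] i" t "int n"] t_s_pow[of i]
      by (simp add: centralizer_def int_pow_int)
    then have "conjugate (t [^] n) (conjugate (s [^] i) x) = conjugate (s [^] i) (conjugate (t [^] n) x)"
      using xG by (intro conjugate_commute) auto
    then show "conjugate (t [^] n) (conjugate (s [^] i) x) \<in> B"
      using n conjugate_s_pow_B by simp
  qed (simp add: xG)
  have conjugate_s: "conjugate s x \<in> A"
    using conjugate_s_pow[of 1] by (simp add: int_pow_1)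
  have conjugate_s_inv: "conjugate (inv s) x \<in> A"
    using conjugate_s_pow[of "- 1"] by (simp add: int_pow_neg int_pow_1)
  have conjugate_t: "conjugate t x \<in> A"
  proof (rule mem_A_if)
    show "conjugate (t [^] n) (conjugate t x) \<in> B"
      using conjugate_t_pow_mono[OF xG n, of "Suc n"] xG by (simp add: conjugate_conjugate)
  qed (simp add: xG)
  have conjugate_t_inv: "conjugate (inv t) x \<in> A"
  proof (rule mem_A_if)
    have "conjugate (t [^] Suc n) (conjugate (inv t) x) = conjugate (t [^] n) x"
      using xG by (simp add: conjugate_conjugate m_assoc)
    then show "conjugate (t [^] Suc n) (conjugate (inv t) x) \<in> B"
      using n by simp
  qed (simp add: xG)
  show ?thesis
    using g conjugate_a conjugate_s conjugate_s_inv conjugate_t conjugate_t_inv by blast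
qed

lemma normal_A: "A \<lhd> G"
proof (rule normal_invI[OF subgroup_A])
  fix g x assume g: "g \<in> carrier G" and x: "x \<in> A"
  have "g \<in> generate G {a, s, t}"
    using g generate by simp
  then have "\<forall>x \<in> A. conjugate g x \<in> A"
  proof (induction rule: generate.induct)
    case (eng h1 h2)
    then have "h1 \<in> carrier G" "h2 \<in> carrier G"
      using generate by auto
    with eng.IH show ?case
      by (auto simp: conjugate_conjugate[symmetric] A_carrier)
  next
    case one
    then show ?case
      using A_carrier by simp
  qed (use conjugate_A_generators in blast)+
  with x show "g \<otimes> x \<otimes> inv g \<in> A"
    by (simp add: conjugate_def)
qed

lemma metabelian_G: "metabelian G"
  unfolding metabelian_def
proof (intro exI conjI)
  show "A \<lhd> G"
    by (rule normal_A)
  show "comm_group (G\<lparr>carrier := A\<rparr>)"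
    using subgroup.subgroup_is_group[OF subgroup_A is_group]
    by (rule group.group_comm_groupI) (simp add: A_commute)
  interpret A: normal A G
    by (rule normal_A)
  have aA: "a \<in> A"
    using B_subset_A[OF b_in_B[of 0]] by (simp add: b_0)
  have ag: "A #> (a \<otimes> g) = A #> (g \<otimes> a)" if g: "g \<in> carrier G" for g
  proof -
    have "A #> (g \<otimes> a) = A #> (conjugate g a \<otimes> g)"
      using g by (simp add: conjugate_def m_assoc)
    also have "\<dots> = A #> g"
      using A.inv_op_closed2[OF g aA] g A.subset
      by (simp add: conjugate_def coset_mult_assoc[symmetric] coset_join2 subgroup_A)
    also have "\<dots> = A #> (a \<otimes> g)"
      using aA g A.subset by (simp add: coset_mult_assoc[symmetric] coset_join2 subgroup_A)
    finally show ?thesis by simp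
  qed
  show "comm_group (G Mod A)"
    by (rule comm_group_quotient_if_generators_commute[OF normal_A _ generate])
      (use ag st in auto)
qed

end

section \<open>The group given by the presentation\<close>

text \<open>The word that consists of the single letter \<open>x\<close>.\<close>

definition free_gen :: "'i \<Rightarrow> ('i \<times> bool) list" where
  "free_gen x = [(x, True)]"

lemma free_gen_closed: "x \<in> S \<Longrightarrow> free_gen x \<in> carrier (free_group S)"
  by (simp add: free_gen_def free_group_def reduced_word_def)

lemma inv_free_gen:
  assumes "x \<in> S"
  shows "inv\<^bsub>free_group S\<^esub> free_gen x = [(x, False)]"
proof -
  interpret F: group "free_group S"
    by (rule group_free_group)
  show ?thesis
    by (rule F.inv_equality)
      (use assms in \<open>auto simp: free_gen_def free_group_def reduced_word_def\<close>)
qed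

lemma generate_free_group: "generate (free_group S) (free_gen ` S) = carrier (free_group S)"
proof
  interpret F: group "free_group S"
    by (rule group_free_group)
  show "generate (free_group S) (free_gen ` S) \<subseteq> carrier (free_group S)"
    by (rule F.generate_incl) (auto simp: free_gen_closed)
  have "w \<in> generate (free_group S) (free_gen ` S)"
    if "reduced_word w" "fst ` set w \<subseteq> S" for w
    using that
  proof (induction w)
    case Nil
    then show ?case
      using generate.one[of "free_group S"] by (simp add: free_group_def)
  next
    case (Cons l w)
    obtain x e where l: "l = (x, e)"
      by (cases l)
    have x: "x \<in> S"
      using Cons.prems by (simp add: l)
    have "[l] \<in> generate (free_group S) (free_gen ` S)"
    proof (cases e)
      case True
      then show ?thesis
        using x by (auto simp: l free_gen_def intro: generate.incl)
    next
      case False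
      then show ?thesis
        using generate.inv[of "free_gen x" "free_gen ` S" "free_group S"] x
        by (simp add: inv_free_gen l)
    qed
    moreover have "w \<in> generate (free_group S) (free_gen ` S)"
      using Cons by (auto dest: reduced_word_ConsD)
    ultimately have "[l] \<otimes>\<^bsub>free_group S\<^esub> w \<in> generate (free_group S) (free_gen ` S)"
      by (rule generate.eng)
    also have "[l] \<otimes>\<^bsub>free_group S\<^esub> w = l # w"
      using Cons.prems by (cases w) (auto simp: free_group_def reduced_word_def)
    finally show ?case .
  qed
  then show "carrier (free_group S) \<subseteq> generate (free_group S) (free_gen ` S)"
    by (auto simp: free_group_def)
qed

context group
begin

text \<open>The value in \<open>G\<close> of a letter, and of a word, when each \<open>x\<close> is replaced by \<open>h x\<close>.\<close>

definition eval_letter :: "('i \<Rightarrow> 'a) \<Rightarrow> 'i \<times> bool \<Rightarrow> 'a" where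
  "eval_letter h l = (if snd l then h (fst l) else inv (h (fst l)))"

definition eval_word :: "('i \<Rightarrow> 'a) \<Rightarrow> ('i \<times> bool) list \<Rightarrow> 'a" where
  "eval_word h w = foldr (\<lambda>l y. eval_letter h l \<otimes> y) w \<one>"

lemma eval_word_simps [simp]:
  "eval_word h [] = \<one>" "eval_word h (l # w) = eval_letter h l \<otimes> eval_word h w"
  by (simp_all add: eval_word_def)

lemma eval_word_hom:
  assumes h: "h \<in> S \<rightarrow> carrier G"
  shows "eval_word h \<in> hom (free_group S) G"
proof -
  have letter: "eval_letter h l \<in> carrier G" if "fst l \<in> S" for l
    using that h by (auto simp: eval_letter_def)
  have closed: "eval_word h w \<in> carrier G" if "fst ` set w \<subseteq> S" for w
    using that letter by (induction w) auto
  have inv_letter: "eval_letter h l \<otimes> eval_letter h (inv_letter l) = \<one>" if "fst l \<in> S" for l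
    using that h by (cases l) (auto simp: eval_letter_def Pi_iff)
  have push: "eval_word h (push_letter l w) = eval_letter h l \<otimes> eval_word h w"
    if "fst l \<in> S" "fst ` set w \<subseteq> S" for l w
  proof (cases w)
    case (Cons m u)
    then show ?thesis
      using that letter closed inv_letter[of l] m_assoc[of "eval_letter h l" "eval_letter h (inv_letter l)" "eval_word h u"]
      by auto
  qed simp
  have mult: "eval_word h (foldr push_letter u v) = eval_word h u \<otimes> eval_word h v"
    if "fst ` set u \<subseteq> S" "fst ` set v \<subseteq> S" for u v
    using that(1)
  proof (induction u)
    case Nil
    then show ?case
      using closed[OF that(2)] by simp
  next
    case (Cons l u)
    have "fst ` set (foldr push_letter u v) \<subseteq> S"
      by (rule order_trans[OF letters_foldr]) (use Cons.prems that(2) in auto)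
    then show ?case
      using Cons that(2) letter closed by (simp add: push m_assoc)
  qed
  show ?thesis
    by (auto simp: hom_def free_group_def closed mult)
qed

lemma eval_word_gen: "h x \<in> carrier G \<Longrightarrow> eval_word h (free_gen x) = h x"
  by (simp add: free_gen_def eval_letter_def)

lemma normal_closure:
  assumes R: "R \<subseteq> carrier G"
  shows "normal_closure G R \<lhd> G" "R \<subseteq> normal_closure G R"
proof -
  have car: "carrier G \<in> {N. N \<lhd> G \<and> R \<subseteq> N}"
    using R normal_self by simp
  have "subgroup (normal_closure G R) G"
    unfolding normal_closure_def
    by (rule subgroups_Inter) (use car in \<open>auto simp: normal_inv_iff\<close>)
  then show "normal_closure G R \<lhd> G"
    by (rule normal_invI) (auto simp: normal_closure_def normal_inv_iff)
  show "R \<subseteq> normal_closure G R"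
    by (auto simp: normal_closure_def)
qed

lemma normal_closure_minimal: "N \<lhd> G \<Longrightarrow> R \<subseteq> N \<Longrightarrow> normal_closure G R \<subseteq> N"
  by (auto simp: normal_closure_def)

end

text \<open>A relation with sides \<open>l\<close> and \<open>r\<close> gives the relator \<open>l r\<^sup>-\<^sup>1\<close>. The generators \<open>a\<close>, \<open>s\<close>, \<open>t\<close> are the
  letters \<open>0\<close>, \<open>1\<close>, \<open>2\<close>.\<close>

definition relators :: "(nat \<times> bool) list set" where
  "relators = (\<lambda>(l, r). l \<otimes>\<^bsub>free_group {..<3}\<^esub> inv\<^bsub>free_group {..<3}\<^esub> r) `
     baumslag_relations (free_group {..<3}) (free_gen 0) (free_gen 1) (free_gen 2)"

abbreviation relator_closure :: "(nat \<times> bool) list set" where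
  "relator_closure \<equiv> normal_closure (free_group {..<3}) relators"

text \<open>The presented group is a set of cosets of words. Numbering the words carries it over to the type
  of natural numbers: a coset is represented by the number of one of its elements, which determines it.\<close>

definition coset_code :: "(nat \<times> bool) list set \<Rightarrow> nat" where
  "coset_code C = to_nat (SOME w. w \<in> C)"

text \<open>The presented group, with natural numbers as elements.\<close>

definition baumslag_group :: "nat monoid" where
  "baumslag_group = image_group coset_code (free_group {..<3} Mod relator_closure)"

text \<open>The element of the group that a word in the generators represents.\<close>

definition word_value :: "(nat \<times> bool) list \<Rightarrow> nat" where
  "word_value w = coset_code (relator_closure #>\<^bsub>free_group {..<3}\<^esub> w)"

interpretation F: group "free_group {..<3 :: nat}"
  by (rule group_free_group)

lemma gens_closed: "free_gen 0 \<in> carrier (free_group {..<3 :: nat})"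
  "free_gen 1 \<in> carrier (free_group {..<3 :: nat})" "free_gen 2 \<in> carrier (free_group {..<3 :: nat})"
  by (simp_all add: free_gen_closed)

lemma relators_closed: "relators \<subseteq> carrier (free_group {..<3})"
  using F.baumslag_relations_closed[OF gens_closed] by (auto simp: relators_def)

interpretation N: normal relator_closure "free_group {..<3 :: nat}"
  by (rule F.normal_closure(1)[OF relators_closed])

interpretation Q: group "free_group {..<3 :: nat} Mod relator_closure"
  by (rule N.factorgroup_is_group)

lemma inj_coset_code: "inj_on coset_code (carrier (free_group {..<3} Mod relator_closure))"
proof (rule inj_onI)
  fix C D
  assume CD: "C \<in> carrier (free_group {..<3} Mod relator_closure)"
    "D \<in> carrier (free_group {..<3} Mod relator_closure)" and eq: "coset_code C = coset_code D"
  have C: "C \<in> rcosets\<^bsub>free_group {..<3}\<^esub> relator_closure"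
    and D: "D \<in> rcosets\<^bsub>free_group {..<3}\<^esub> relator_closure"
    using CD by (simp_all add: FactGroup_def)
  have "(SOME w. w \<in> C) \<in> C" "(SOME w. w \<in> D) \<in> D"
    using N.rcosets_non_empty[OF C] N.rcosets_non_empty[OF D] by (simp_all add: some_in_eq)
  moreover have "(SOME w. w \<in> C) = (SOME w. w \<in> D)"
    using eq by (simp add: coset_code_def)
  ultimately have "C \<inter> D \<noteq> {}"
    by auto
  then show "C = D"
    using F.rcos_disjoint[OF N.subgroup_axioms] C D by (auto simp: pairwise_def disjnt_def)
qed

lemma coset_code_iso: "coset_code \<in> iso (free_group {..<3} Mod relator_closure) baumslag_group"
  unfolding baumslag_group_def by (rule inj_imp_image_group_iso[OF inj_coset_code])

lemma group_baumslag_group: "group baumslag_group"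
  unfolding baumslag_group_def by (rule Q.inj_imp_image_group_is_group[OF inj_coset_code])

lemma finitely_presented_baumslag_group: "finitely_presented baumslag_group"
  unfolding finitely_presented_def
proof (intro conjI exI)
  show "baumslag_group \<cong> free_group {..<3} Mod relator_closure"
    using Q.iso_sym coset_code_iso by (auto simp: is_iso_def)
  show "finite relators"
    by (simp add: relators_def baumslag_relations_def)
qed (use group_baumslag_group relators_closed in auto)

interpretation word_value: group_hom "free_group {..<3 :: nat}" baumslag_group word_value
proof -
  have "(\<lambda>w. relator_closure #>\<^bsub>free_group {..<3}\<^esub> w) \<in> hom (free_group {..<3}) (free_group {..<3} Mod relator_closure)"
    by (rule N.r_coset_hom_Mod)
  moreover have "coset_code \<in> hom (free_group {..<3} Mod relator_closure) baumslag_group"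
    using coset_code_iso by (simp add: iso_def)
  ultimately have "coset_code \<circ> (\<lambda>w. relator_closure #>\<^bsub>free_group {..<3}\<^esub> w) \<in> hom (free_group {..<3}) baumslag_group"
    by (rule hom_compose)
  then show "group_hom (free_group {..<3 :: nat}) baumslag_group word_value"
    by (simp add: group_hom_def group_hom_axioms_def group_baumslag_group F.group_axioms word_value_def[abs_def] comp_def)
qed

lemma carrier_baumslag_group: "carrier baumslag_group = word_value ` carrier (free_group {..<3})"
  by (auto simp: baumslag_group_def image_group_def FactGroup_def RCOSETS_def word_value_def)

abbreviation "bg_a \<equiv> word_value (free_gen 0)"
abbreviation "bg_s \<equiv> word_value (free_gen 1)"
abbreviation "bg_t \<equiv> word_value (free_gen 2)"

lemma generate_baumslag_group: "generate baumslag_group {bg_a, bg_s, bg_t} = carrier baumslag_group"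
proof -
  have "{..<3 :: nat} = {0, 1, 2}"
    by auto
  then have "word_value ` free_gen ` {..<3} = {bg_a, bg_s, bg_t}"
    by auto
  moreover have "free_gen ` {..<3 :: nat} \<subseteq> carrier (free_group {..<3})"
    by (auto simp: free_gen_closed)
  ultimately have "generate baumslag_group {bg_a, bg_s, bg_t} = word_value ` generate (free_group {..<3}) (free_gen ` {..<3})"
    using word_value.generate_img[of "free_gen ` {..<3}"] by simp
  then show ?thesis
    by (simp add: generate_free_group carrier_baumslag_group)
qed

lemma bg_closed: "bg_a \<in> carrier baumslag_group" "bg_s \<in> carrier baumslag_group" "bg_t \<in> carrier baumslag_group"
  using gens_closed by (auto simp: carrier_baumslag_group)

lemma baumslag_relations_generators: "baumslag_relations baumslag_group bg_a bg_s bg_t \<subseteq> Id"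
proof -
  have "word_value l = word_value r"
    if lr: "(l, r) \<in> baumslag_relations (free_group {..<3}) (free_gen 0) (free_gen 1) (free_gen 2)" for l r
  proof -
    have l: "l \<in> carrier (free_group {..<3})" and r: "r \<in> carrier (free_group {..<3})"
      using F.baumslag_relations_closed[OF gens_closed lr] by auto
    have "l \<otimes>\<^bsub>free_group {..<3}\<^esub> inv\<^bsub>free_group {..<3}\<^esub> r \<in> relator_closure"
      using lr F.normal_closure(2)[OF relators_closed] by (force simp: relators_def)
    then have "relator_closure #>\<^bsub>free_group {..<3}\<^esub> l = relator_closure #>\<^bsub>free_group {..<3}\<^esub> r"
      using l r N.rcos_module[OF F.group_axioms r l] F.repr_independence[OF _ r N.subgroup_axioms] by auto
    then show ?thesis
      by (simp add: word_value_def)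
  qed
  then show ?thesis
    using word_value.hom_baumslag_relations[OF gens_closed] by auto
qed

text \<open>The universal property of the presentation.\<close>

lemma hom_from_baumslag_group:
  assumes B: "group B" and gens: "a \<in> carrier B" "s \<in> carrier B" "t \<in> carrier B"
    and rels: "baumslag_relations B a s t \<subseteq> Id"
  obtains \<phi> where "\<phi> \<in> hom baumslag_group B" "\<phi> bg_a = a" "\<phi> bg_s = s" "\<phi> bg_t = t"
proof -
  interpret B: group B by (rule B)
  define h where "h i = (if i = (0::nat) then a else if i = 1 then s else t)" for i
  interpret e: group_hom "free_group {..<3}" B "B.eval_word h"
    using B.eval_word_hom[of h "{..<3}"] gens B
    by (auto simp: group_hom_def group_hom_axioms_def h_def group_free_group)
  have vals: "B.eval_word h (free_gen 0) = a" "B.eval_word h (free_gen 1) = s" "B.eval_word h (free_gen 2) = t"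
    using gens by (simp_all add: B.eval_word_gen h_def)
  have "B.eval_word h l = B.eval_word h r"
    if "(l, r) \<in> baumslag_relations (free_group {..<3}) (free_gen 0) (free_gen 1) (free_gen 2)" for l r
    using e.hom_baumslag_relations[OF gens_closed] rels that unfolding vals by force
  then have "relators \<subseteq> kernel (free_group {..<3}) B (B.eval_word h)"
    using relators_closed F.baumslag_relations_closed[OF gens_closed]
    by (auto simp: relators_def kernel_def)
  then have "relator_closure \<subseteq> kernel (free_group {..<3}) B (B.eval_word h)"
    by (rule F.normal_closure_minimal[OF e.normal_kernel])
  then obtain \<psi> where \<psi>: "\<psi> \<in> hom (free_group {..<3} Mod relator_closure) B"
    and \<psi>_eq: "\<And>w. w \<in> carrier (free_group {..<3}) \<Longrightarrow>
      \<psi> (relator_closure #>\<^bsub>free_group {..<3}\<^esub> w) = B.eval_word h w"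
    using e.FactGroup_universal_kernel[OF N.normal_axioms] by blast
  let ?d = "inv_into (carrier (free_group {..<3} Mod relator_closure)) coset_code"
  have "?d \<in> hom baumslag_group (free_group {..<3} Mod relator_closure)"
    using Q.iso_set_sym[OF coset_code_iso] by (simp add: iso_def)
  then have hom: "\<psi> \<circ> ?d \<in> hom baumslag_group B"
    using \<psi> by (rule hom_compose)
  have "(\<psi> \<circ> ?d) (word_value w) = B.eval_word h w" if "w \<in> carrier (free_group {..<3})" for w
  proof -
    have "?d (word_value w) = relator_closure #>\<^bsub>free_group {..<3}\<^esub> w"
      unfolding word_value_def using that
      by (intro inv_into_f_f[OF inj_coset_code]) (auto simp: FactGroup_def RCOSETS_def)
    then show ?thesis
      using \<psi>_eq[OF that] by simp
  qed
  with that[OF hom] vals gens_closed show thesis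
    by simp
qed

section \<open>A lower bound for the first homology\<close>

text \<open>The value at \<open>c\<close> of the linear extension of \<open>f\<close>, where \<open>c\<close> is a finitely supported function
  that stands for a formal linear combination.\<close>

definition lin_ext ::
  "('r, 's) ring_scheme \<Rightarrow> ('b \<Rightarrow> 'r) \<Rightarrow> ('b \<Rightarrow> 'r) \<Rightarrow> 'r" where
  "lin_ext R f c = (\<Oplus>\<^bsub>R\<^esub>x\<in>{x. c x \<noteq> \<zero>\<^bsub>R\<^esub>}. c x \<otimes>\<^bsub>R\<^esub> f x)"

text \<open>The formal linear combination \<open>r\<cdot>x\<close>.\<close>

definition single_chain :: "('r, 's) ring_scheme \<Rightarrow> 'r \<Rightarrow> 'b \<Rightarrow> 'b \<Rightarrow> 'r" where
  "single_chain R r x y = (if y = x then r else \<zero>\<^bsub>R\<^esub>)"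

lemma carrier_bar_chains:
  "c \<in> carrier (bar_chains R G n) \<longleftrightarrow>
    (\<forall>gs. c gs \<in> carrier R) \<and> finite {gs. c gs \<noteq> \<zero>\<^bsub>R\<^esub>} \<and>
    (\<forall>gs. c gs \<noteq> \<zero>\<^bsub>R\<^esub> \<longrightarrow> length gs = n \<and> set gs \<subseteq> carrier G)"
  by (simp add: bar_chains_def)

lemma bar_chains_simps [simp]:
  "zero (bar_chains R G n) = (\<lambda>_. \<zero>\<^bsub>R\<^esub>)"
  "add (bar_chains R G n) c d = (\<lambda>gs. c gs \<oplus>\<^bsub>R\<^esub> d gs)"
  "smult (bar_chains R G n) r c = (\<lambda>gs. r \<otimes>\<^bsub>R\<^esub> c gs)"
  by (simp_all add: bar_chains_def)

lemma (in cring) lin_ext_eq_finsum: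
  assumes "finite A" "{x. c x \<noteq> \<zero>} \<subseteq> A" "\<And>x. c x \<in> carrier R" "\<And>x. f x \<in> carrier R"
  shows "lin_ext R f c = (\<Oplus>x\<in>A. c x \<otimes> f x)"
  unfolding lin_ext_def
  by (rule add.finprod_mono_neutral_cong_left) (use assms in auto)

lemma (in cring) lin_ext_closed:
  assumes "\<And>x. c x \<in> carrier R" "\<And>x. f x \<in> carrier R"
  shows "lin_ext R f c \<in> carrier R"
  unfolding lin_ext_def by (rule finsum_closed) (use assms in auto)

lemma (in cring) lin_ext_add:
  assumes "finite {x. c x \<noteq> \<zero>}" "finite {x. d x \<noteq> \<zero>}"
    and "\<And>x. c x \<in> carrier R" "\<And>x. d x \<in> carrier R" "\<And>x. f x \<in> carrier R"
  shows "lin_ext R f (\<lambda>x. c x \<oplus> d x) = lin_ext R f c \<oplus> lin_ext R f d"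
proof -
  let ?A = "{x. c x \<noteq> \<zero>} \<union> {x. d x \<noteq> \<zero>}"
  have "lin_ext R f (\<lambda>x. c x \<oplus> d x) = (\<Oplus>x\<in>?A. (c x \<oplus> d x) \<otimes> f x)"
    by (rule lin_ext_eq_finsum) (use assms in auto)
  also have "\<dots> = (\<Oplus>x\<in>?A. c x \<otimes> f x \<oplus> d x \<otimes> f x)"
    using assms by (simp add: l_distr)
  also have "\<dots> = (\<Oplus>x\<in>?A. c x \<otimes> f x) \<oplus> (\<Oplus>x\<in>?A. d x \<otimes> f x)"
    by (rule finsum_addf) (use assms in auto)
  also have "\<dots> = lin_ext R f c \<oplus> lin_ext R f d"
    using assms by (subst (1 2) lin_ext_eq_finsum[where A = ?A]) auto
  finally show ?thesis .
qed

lemma (in cring) lin_ext_smult: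
  assumes "finite {x. c x \<noteq> \<zero>}" "r \<in> carrier R"
    and "\<And>x. c x \<in> carrier R" "\<And>x. f x \<in> carrier R"
  shows "lin_ext R f (\<lambda>x. r \<otimes> c x) = r \<otimes> lin_ext R f c"
proof -
  let ?A = "{x. c x \<noteq> \<zero>}"
  have "lin_ext R f (\<lambda>x. r \<otimes> c x) = (\<Oplus>x\<in>?A. (r \<otimes> c x) \<otimes> f x)"
    by (rule lin_ext_eq_finsum) (use assms in auto)
  also have "\<dots> = (\<Oplus>x\<in>?A. r \<otimes> (c x \<otimes> f x))"
    using assms by (simp add: m_assoc)
  also have "\<dots> = r \<otimes> lin_ext R f c"
    unfolding lin_ext_def by (rule finsum_rdistr[symmetric]) (use assms in auto)
  finally show ?thesis .
qed

lemma (in cring) lin_ext_zero: "lin_ext R f (\<lambda>_. \<zero>) = \<zero>"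
  by (simp add: lin_ext_def)

lemma (in cring) lin_ext_single_chain:
  assumes "r \<in> carrier R" "\<And>x. f x \<in> carrier R"
  shows "lin_ext R f (single_chain R r x) = r \<otimes> f x"
proof -
  have "lin_ext R f (single_chain R r x) = (\<Oplus>y\<in>{x}. single_chain R r x y \<otimes> f y)"
    by (rule lin_ext_eq_finsum) (use assms in \<open>auto simp: single_chain_def\<close>)
  then show ?thesis
    using assms by (simp add: single_chain_def)
qed

lemma (in cring) module_bar_chains: "module R (bar_chains R G n)"
proof (rule moduleI)
  show "abelian_group (bar_chains R G n)"
  proof (rule abelian_groupI)
    fix c d assume c: "c \<in> carrier (bar_chains R G n)" and d: "d \<in> carrier (bar_chains R G n)"
    have "{gs. c gs \<oplus> d gs \<noteq> \<zero>} \<subseteq> {gs. c gs \<noteq> \<zero>} \<union> {gs. d gs \<noteq> \<zero>}"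
      by auto
    then have "finite {gs. c gs \<oplus> d gs \<noteq> \<zero>}"
      using c d by (auto simp: carrier_bar_chains intro: finite_subset)
    then show "c \<oplus>\<^bsub>bar_chains R G n\<^esub> d \<in> carrier (bar_chains R G n)"
      using c d by (simp add: carrier_bar_chains) (metis l_zero zero_closed)
  next
    fix c assume c: "c \<in> carrier (bar_chains R G n)"
    have 0: "\<ominus> x = \<zero> \<longleftrightarrow> x = \<zero>" if "x \<in> carrier R" for x
      using that by (metis minus_minus minus_zero)
    show "\<exists>d \<in> carrier (bar_chains R G n). d \<oplus>\<^bsub>bar_chains R G n\<^esub> c = \<zero>\<^bsub>bar_chains R G n\<^esub>"
    proof
      show "(\<lambda>gs. \<ominus> c gs) \<in> carrier (bar_chains R G n)"
        using c by (simp add: carrier_bar_chains 0)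
      show "(\<lambda>gs. \<ominus> c gs) \<oplus>\<^bsub>bar_chains R G n\<^esub> c = \<zero>\<^bsub>bar_chains R G n\<^esub>"
        using c by (simp add: carrier_bar_chains l_neg)
    qed
  qed (auto simp: carrier_bar_chains a_ac fun_eq_iff)
next
  fix r c assume r: "r \<in> carrier R" and c: "c \<in> carrier (bar_chains R G n)"
  have "{gs. r \<otimes> c gs \<noteq> \<zero>} \<subseteq> {gs. c gs \<noteq> \<zero>}"
    using r by auto
  then show "r \<odot>\<^bsub>bar_chains R G n\<^esub> c \<in> carrier (bar_chains R G n)"
    using r c by (auto simp: carrier_bar_chains intro: finite_subset)
qed (auto simp: carrier_bar_chains l_distr r_distr m_assoc fun_eq_iff cring_axioms)

lemma (in cring) single_chain_in_bar_chains:
  assumes "r \<in> carrier R" "length gs = n" "set gs \<subseteq> carrier G"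
  shows "single_chain R r gs \<in> carrier (bar_chains R G n)"
proof -
  have "{hs. single_chain R r gs hs \<noteq> \<zero>} \<subseteq> {gs}"
    by (auto simp: single_chain_def)
  then have "finite {hs. single_chain R r gs hs \<noteq> \<zero>}"
    by (rule finite_subset) simp
  then show ?thesis
    using assms by (auto simp: carrier_bar_chains single_chain_def)
qed

lemma (in cring) bar_chain_induct [consumes 1, case_names zero add]:
  assumes c: "c \<in> carrier (bar_chains R G n)"
    and zero: "P (\<lambda>_. \<zero>)"
    and add: "\<And>c r gs. \<lbrakk>c \<in> carrier (bar_chains R G n); P c; r \<in> carrier R; length gs = n;
      set gs \<subseteq> carrier G\<rbrakk> \<Longrightarrow> P (\<lambda>hs. c hs \<oplus> single_chain R r gs hs)"
  shows "P c"
proof -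
  have "\<forall>c. c \<in> carrier (bar_chains R G n) \<longrightarrow> {gs. c gs \<noteq> \<zero>} \<subseteq> S \<longrightarrow> P c" if "finite S" for S
    using that
  proof (induction S)
    case empty
    have "P c" if "{gs. c gs \<noteq> \<zero>} \<subseteq> {}" for c
    proof -
      have "c = (\<lambda>_. \<zero>)"
        using that by auto
      with zero show ?thesis by simp
    qed
    then show ?case by blast
  next
    case (insert gs S)
    show ?case
    proof (intro allI impI)
      fix c assume c: "c \<in> carrier (bar_chains R G n)" and supp: "{hs. c hs \<noteq> \<zero>} \<subseteq> insert gs S"
      let ?d = "\<lambda>hs. if hs = gs then \<zero> else c hs"
      have "{hs. ?d hs \<noteq> \<zero>} \<subseteq> {hs. c hs \<noteq> \<zero>}"
        by auto
      then have d: "?d \<in> carrier (bar_chains R G n)"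
        using c by (auto simp: carrier_bar_chains intro: finite_subset)
      moreover have "{hs. ?d hs \<noteq> \<zero>} \<subseteq> S"
        using supp by auto
      ultimately have Pd: "P ?d"
        using insert.IH by blast
      show "P c"
      proof (cases "c gs = \<zero>")
        case True
        then have "?d = c"
          by auto
        with Pd show ?thesis by simp
      next
        case False
        have "P (\<lambda>hs. ?d hs \<oplus> single_chain R (c gs) gs hs)"
          by (rule add[OF d Pd]) (use c False in \<open>auto simp: carrier_bar_chains\<close>)
        also have "(\<lambda>hs. ?d hs \<oplus> single_chain R (c gs) gs hs) = c"
          using c by (auto simp: single_chain_def carrier_bar_chains)
        finally show ?thesis .
      qed
    qed
  qed
  from this[of "{gs. c gs \<noteq> \<zero>}"] show ?thesis
    using c by (auto simp: carrier_bar_chains)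
qed

text \<open>The coefficient of the tuple \<open>hs\<close> in the boundary of the tuple \<open>gs\<close> of length \<open>n\<close>.\<close>

definition incidence ::
  "('r, 's) ring_scheme \<Rightarrow> ('a, 'm) monoid_scheme \<Rightarrow> nat \<Rightarrow> 'a list \<Rightarrow> 'a list \<Rightarrow> 'r" where
  "incidence R G n hs gs =
    (\<Oplus>\<^bsub>R\<^esub>i\<in>{i. i \<le> n \<and> bar_face G gs i = hs}. (\<ominus>\<^bsub>R\<^esub> \<one>\<^bsub>R\<^esub>) [^]\<^bsub>R\<^esub> i)"

lemma (in cring) incidence_closed [simp]: "incidence R G n hs gs \<in> carrier R"
  unfolding incidence_def by (rule finsum_closed) auto

lemma (in cring) incidence_eq_sum:
  "incidence R G n hs gs = (\<Oplus>i\<in>{..n}. if bar_face G gs i = hs then (\<ominus> \<one>) [^] i else \<zero>)"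
  unfolding incidence_def by (rule add.finprod_mono_neutral_cong_left) auto

lemma (in cring) bar_boundary_eq_lin_ext:
  assumes "\<And>gs. c gs \<in> carrier R"
  shows "bar_boundary R G (Suc n) c hs = lin_ext R (incidence R G (Suc n) hs) c"
proof -
  have "(\<Oplus>i\<in>{i. i \<le> Suc n \<and> bar_face G gs i = hs}. ((\<ominus> \<one>) [^] i) \<otimes> c gs) =
      c gs \<otimes> incidence R G (Suc n) hs gs" for gs
    unfolding incidence_def using assms by (subst finsum_ldistr[symmetric]) (auto simp: m_comm)
  then show ?thesis
    using assms by (simp add: bar_boundary_def lin_ext_def)
qed

lemma (in cring) bar_boundary_add:
  assumes "c \<in> carrier (bar_chains R G (Suc n))" "d \<in> carrier (bar_chains R G (Suc n))"
  shows "bar_boundary R G (Suc n) (\<lambda>gs. c gs \<oplus> d gs) =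
    (\<lambda>hs. bar_boundary R G (Suc n) c hs \<oplus> bar_boundary R G (Suc n) d hs)"
  using assms by (intro ext) (simp add: bar_boundary_eq_lin_ext carrier_bar_chains lin_ext_add)

lemma (in cring) bar_boundary_smult:
  assumes "c \<in> carrier (bar_chains R G (Suc n))" "r \<in> carrier R"
  shows "bar_boundary R G (Suc n) (\<lambda>gs. r \<otimes> c gs) =
    (\<lambda>hs. r \<otimes> bar_boundary R G (Suc n) c hs)"
  using assms by (intro ext) (simp add: bar_boundary_eq_lin_ext carrier_bar_chains lin_ext_smult)

lemma (in cring) bar_boundary_zero: "bar_boundary R G (Suc n) (\<lambda>_. \<zero>) = (\<lambda>_. \<zero>)"
  by (rule ext) (simp add: bar_boundary_eq_lin_ext lin_ext_zero)

lemma (in monoid) bar_face_tuple: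
  assumes "length gs = Suc n" "set gs \<subseteq> carrier G" "i \<le> Suc n"
  shows "length (bar_face G gs i) = n" "set (bar_face G gs i) \<subseteq> carrier G"
proof -
  consider "i = 0" | "i = Suc n" | "0 < i" "i \<le> n"
    using assms(3) by linarith
  then have "length (bar_face G gs i) = n \<and> set (bar_face G gs i) \<subseteq> carrier G"
  proof cases
    case 1
    then show ?thesis
      using assms by (cases gs) (auto simp: bar_face_def)
  next
    case 2
    then show ?thesis
      using assms by (auto simp: bar_face_def dest: in_set_butlastD)
  next
    case 3
    then have "gs ! (i - 1) \<in> carrier G" "gs ! i \<in> carrier G"
      using assms by (auto simp: subset_iff)
    then show ?thesis
      using 3 assms by (auto simp: bar_face_def dest: in_set_takeD in_set_dropD)
  qed
  then show "length (bar_face G gs i) = n" "set (bar_face G gs i) \<subseteq> carrier G"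
    by auto
qed

lemma (in cring) bar_boundary_closed:
  assumes G: "monoid G" and c: "c \<in> carrier (bar_chains R G (Suc n))"
  shows "bar_boundary R G (Suc n) c \<in> carrier (bar_chains R G n)"
proof -
  let ?S = "{gs. c gs \<noteq> \<zero>}"
  have cl: "c gs \<in> carrier R" for gs
    using c by (simp add: carrier_bar_chains)
  have supp: "\<exists>gs \<in> ?S. \<exists>i \<le> Suc n. hs = bar_face G gs i"
    if "bar_boundary R G (Suc n) c hs \<noteq> \<zero>" for hs
  proof (rule ccontr)
    assume "\<not> ?thesis"
    then have "{i. i \<le> Suc n \<and> bar_face G gs i = hs} = {}" if "gs \<in> ?S" for gs
      using that by blast
    then have "incidence R G (Suc n) hs gs = \<zero>" if "gs \<in> ?S" for gs
      using that by (simp only: incidence_def finsum_empty)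
    then have "lin_ext R (incidence R G (Suc n) hs) c = \<zero>"
      unfolding lin_ext_def using cl by (intro add.finprod_one_eqI) auto
    then show False
      using that cl by (simp add: bar_boundary_eq_lin_ext)
  qed
  have "{hs. bar_boundary R G (Suc n) c hs \<noteq> \<zero>} \<subseteq> (\<lambda>(gs, i). bar_face G gs i) ` (?S \<times> {..Suc n})"
    using supp by fastforce
  then have "finite {hs. bar_boundary R G (Suc n) c hs \<noteq> \<zero>}"
    by (rule finite_subset) (use c in \<open>simp add: carrier_bar_chains\<close>)
  moreover have "length hs = n \<and> set hs \<subseteq> carrier G"
    if nz: "bar_boundary R G (Suc n) c hs \<noteq> \<zero>" for hs
  proof -
    obtain gs i where "c gs \<noteq> \<zero>" "i \<le> Suc n" "hs = bar_face G gs i"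
      using supp[OF nz] by auto
    then show ?thesis
      using monoid.bar_face_tuple[OF G, of gs n i] c by (simp add: carrier_bar_chains)
  qed
  moreover have "bar_boundary R G (Suc n) c hs \<in> carrier R" for hs
    using cl by (simp add: bar_boundary_eq_lin_ext lin_ext_closed)
  ultimately show ?thesis
    by (simp add: carrier_bar_chains)
qed

lemma (in cring) submodule_bar_boundaries:
  assumes "monoid G"
  shows "LinearCombinations.submodule R (bar_boundaries R G n) (bar_chains R G n)"
proof -
  interpret C: module R "bar_chains R G (Suc n)"
    by (rule module_bar_chains)
  show ?thesis
  proof (rule LinearCombinations.submodule.intro[OF module_bar_chains])
    show "bar_boundaries R G n \<subseteq> carrier (bar_chains R G n)"
      using bar_boundary_closed[OF assms] by (auto simp: bar_boundaries_def)
  next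
    fix v w assume "v \<in> bar_boundaries R G n" "w \<in> bar_boundaries R G n"
    then obtain c d where "c \<in> carrier (bar_chains R G (Suc n))" "d \<in> carrier (bar_chains R G (Suc n))"
      and "v = bar_boundary R G (Suc n) c" "w = bar_boundary R G (Suc n) d"
      by (auto simp: bar_boundaries_def)
    then show "v \<oplus>\<^bsub>bar_chains R G n\<^esub> w \<in> bar_boundaries R G n"
      using C.M.a_closed[of c d] bar_boundary_add[of c G n d]
      by (auto simp: bar_boundaries_def intro!: image_eqI[where x = "\<lambda>gs. c gs \<oplus> d gs"])
  next
    show "\<zero>\<^bsub>bar_chains R G n\<^esub> \<in> bar_boundaries R G n"
      using C.M.zero_closed bar_boundary_zero[of G n]
      by (auto simp: bar_boundaries_def intro!: image_eqI[where x = "\<lambda>_. \<zero>"])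
  next
    fix r v assume "r \<in> carrier R" "v \<in> bar_boundaries R G n"
    then obtain c where "r \<in> carrier R" "c \<in> carrier (bar_chains R G (Suc n))"
      and "v = bar_boundary R G (Suc n) c"
      by (auto simp: bar_boundaries_def)
    then show "r \<odot>\<^bsub>bar_chains R G n\<^esub> v \<in> bar_boundaries R G n"
      using C.smult_closed[of r c] bar_boundary_smult[of c G n r]
      by (auto simp: bar_boundaries_def intro!: image_eqI[where x = "\<lambda>gs. r \<otimes> c gs"])
  qed
qed

lemma (in module) abelian_subgroup_submodule:
  assumes "LinearCombinations.submodule R N M"
  shows "abelian_subgroup N M"
proof (rule abelian_subgroupI3)
  interpret N: LinearCombinations.submodule R N M
    by (rule assms)
  show "additive_subgroup N M"
  proof (rule additive_subgroupI, rule M.add.subgroupI)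
    fix x assume x: "x \<in> N"
    then have "(\<ominus> \<one>) \<odot>\<^bsub>M\<^esub> x \<in> N"
      by simp
    also have "(\<ominus> \<one>) \<odot>\<^bsub>M\<^esub> x = \<ominus>\<^bsub>M\<^esub> x"
      using x N.subset smult_minus_1[of x] by auto
    finally show "\<ominus>\<^bsub>M\<^esub> x \<in> N" .
  next
    show "N \<noteq> {}"
      using N.zero_closed by blast
  qed (use N.subset in auto)
qed (rule M.abelian_group_axioms)

lemma carrier_quotient_module:
  "carrier (quotient_module M N) = (\<lambda>x. N +>\<^bsub>M\<^esub> x) ` carrier M"
  by (auto simp: quotient_module_def A_RCOSETS_def RCOSETS_def a_r_coset_def)

lemma (in module) module_quotient_module:
  assumes N: "LinearCombinations.submodule R N M"
  shows "module R (quotient_module M N)"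
    and "\<lbrakk>r \<in> carrier R; x \<in> carrier M\<rbrakk> \<Longrightarrow>
      r \<odot>\<^bsub>quotient_module M N\<^esub> (N +>\<^bsub>M\<^esub> x) = N +>\<^bsub>M\<^esub> (r \<odot>\<^bsub>M\<^esub> x)"
    and "\<lbrakk>x \<in> carrier M; y \<in> carrier M\<rbrakk> \<Longrightarrow>
      (N +>\<^bsub>M\<^esub> x) \<oplus>\<^bsub>quotient_module M N\<^esub> (N +>\<^bsub>M\<^esub> y) = N +>\<^bsub>M\<^esub> (x \<oplus>\<^bsub>M\<^esub> y)"
proof -
  interpret N: LinearCombinations.submodule R N M
    by (rule N)
  interpret A: abelian_subgroup N M
    by (rule abelian_subgroup_submodule[OF N])
  let ?Q = "quotient_module M N"
  note car = carrier_quotient_module[of M N]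
  show add: "(N +>\<^bsub>M\<^esub> x) \<oplus>\<^bsub>?Q\<^esub> (N +>\<^bsub>M\<^esub> y) = N +>\<^bsub>M\<^esub> (x \<oplus>\<^bsub>M\<^esub> y)"
    if "x \<in> carrier M" "y \<in> carrier M" for x y
    using A.a_rcos_sum[OF that] by (simp add: quotient_module_def)
  show smult: "r \<odot>\<^bsub>?Q\<^esub> (N +>\<^bsub>M\<^esub> x) = N +>\<^bsub>M\<^esub> (r \<odot>\<^bsub>M\<^esub> x)"
    if r: "r \<in> carrier R" and x: "x \<in> carrier M" for r x
  proof -
    \<comment> \<open>The union in the definition of the scalar multiplication is over equal cosets.\<close>
    have const: "N +>\<^bsub>M\<^esub> (r \<odot>\<^bsub>M\<^esub> y) = N +>\<^bsub>M\<^esub> (r \<odot>\<^bsub>M\<^esub> x)" if "y \<in> N +>\<^bsub>M\<^esub> x" for y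
    proof -
      from that obtain n where n: "n \<in> N" "y = n \<oplus>\<^bsub>M\<^esub> x"
        by (auto simp: a_r_coset_def r_coset_def)
      then have "r \<odot>\<^bsub>M\<^esub> y = r \<odot>\<^bsub>M\<^esub> n \<oplus>\<^bsub>M\<^esub> r \<odot>\<^bsub>M\<^esub> x"
        using r x N.subset by (auto simp: smult_r_distr)
      also have "N +>\<^bsub>M\<^esub> \<dots> = (N +>\<^bsub>M\<^esub> (r \<odot>\<^bsub>M\<^esub> n)) <+>\<^bsub>M\<^esub> (N +>\<^bsub>M\<^esub> (r \<odot>\<^bsub>M\<^esub> x))"
        using r x n(1) N.subset by (subst A.a_rcos_sum) auto
      also have "N +>\<^bsub>M\<^esub> (r \<odot>\<^bsub>M\<^esub> n) = N +>\<^bsub>M\<^esub> \<zero>\<^bsub>M\<^esub>"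
        using r n(1) N.zero_closed A.a_rcos_const by simp
      also have "(N +>\<^bsub>M\<^esub> \<zero>\<^bsub>M\<^esub>) <+>\<^bsub>M\<^esub> (N +>\<^bsub>M\<^esub> (r \<odot>\<^bsub>M\<^esub> x)) = N +>\<^bsub>M\<^esub> (r \<odot>\<^bsub>M\<^esub> x)"
        using r x by (subst A.a_rcos_sum) auto
      finally show ?thesis .
    qed
    have "r \<odot>\<^bsub>?Q\<^esub> (N +>\<^bsub>M\<^esub> x) = (\<Union>y \<in> N +>\<^bsub>M\<^esub> x. N +>\<^bsub>M\<^esub> (r \<odot>\<^bsub>M\<^esub> y))"
      by (simp add: quotient_module_def)
    also have "\<dots> = (\<Union>y \<in> N +>\<^bsub>M\<^esub> x. N +>\<^bsub>M\<^esub> (r \<odot>\<^bsub>M\<^esub> x))"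
      by (rule SUP_cong[OF refl const])
    also have "\<dots> = N +>\<^bsub>M\<^esub> (r \<odot>\<^bsub>M\<^esub> x)"
      using A.a_rcos_self[OF x] by blast
    finally show ?thesis .
  qed
  have zero: "\<zero>\<^bsub>?Q\<^esub> = N +>\<^bsub>M\<^esub> \<zero>\<^bsub>M\<^esub>"
    unfolding A.a_rcos_const[OF A.zero_closed] by (simp add: quotient_module_def)
  have Q: "abelian_group ?Q"
  proof (rule abelian_groupI)
    fix X assume "X \<in> carrier ?Q"
    then obtain x where x: "x \<in> carrier M" "X = N +>\<^bsub>M\<^esub> x"
      by (auto simp: car)
    then have "(N +>\<^bsub>M\<^esub> \<ominus>\<^bsub>M\<^esub> x) \<oplus>\<^bsub>?Q\<^esub> X = \<zero>\<^bsub>?Q\<^esub>"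
      by (simp add: add zero M.l_neg)
    with x show "\<exists>Y \<in> carrier ?Q. Y \<oplus>\<^bsub>?Q\<^esub> X = \<zero>\<^bsub>?Q\<^esub>"
      by (auto simp: car)
  qed (auto simp: car add zero M.a_ac)
  show "module R ?Q"
    by (rule moduleI[OF R.cring_axioms Q])
      (auto simp: car smult add smult_l_distr smult_r_distr smult_assoc1)
qed

text \<open>Both faces of \<open>[g]\<close> are the empty tuple, with opposite signs.\<close>

lemma (in cring) bar_cycles_1: "bar_cycles R G 1 = carrier (bar_chains R G 1)"
proof -
  have "bar_boundary R G 1 c = (\<lambda>_. \<zero>)" if c: "c \<in> carrier (bar_chains R G 1)" for c
  proof
    fix hs
    have "incidence R G 1 hs gs = \<zero>" if "c gs \<noteq> \<zero>" for gs
    proof -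
      have "length gs = 1"
        using c that by (simp add: carrier_bar_chains)
      then have "bar_face G gs 0 = []" "bar_face G gs (Suc 0) = []"
        by (cases gs; simp add: bar_face_def)+
      then show ?thesis
        by (simp add: incidence_eq_sum l_neg)
    qed
    then have "lin_ext R (incidence R G 1 hs) c = \<zero>"
      unfolding lin_ext_def using c by (intro add.finprod_one_eqI) (auto simp: carrier_bar_chains)
    then show "bar_boundary R G 1 c hs = \<zero>"
      using c bar_boundary_eq_lin_ext[of c G 0 hs] by (simp add: carrier_bar_chains)
  qed
  then show ?thesis
    by (auto simp: bar_cycles_def)
qed

lemma (in cring) group_homology_1:
  "group_homology R G 1 = quotient_module (bar_chains R G 1) (bar_boundaries R G 1)"
  unfolding group_homology_def bar_cycles_1 by simp

lemma (in cring) bar_boundary_single_chain_2: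
  assumes r: "r \<in> carrier R"
  shows "bar_boundary R G (Suc 1) (single_chain R r [g, h]) =
    (\<lambda>hs. single_chain R r [h] hs \<oplus> (single_chain R (\<ominus> r) [g \<otimes>\<^bsub>G\<^esub> h] hs \<oplus> single_chain R r [g] hs))"
proof
  fix hs
  have cl: "single_chain R r [g, h] gs \<in> carrier R" for gs
    using r by (simp add: single_chain_def)
  have sq: "(\<ominus> \<one>) [^] Suc (Suc 0) = \<one>" "(\<ominus> \<one>) \<otimes> (\<ominus> \<one>) = \<one>"
    by (simp_all add: l_minus)
  have faces: "bar_face G [g, h] 0 = [h]" "bar_face G [g, h] (Suc 0) = [g \<otimes>\<^bsub>G\<^esub> h]"
    "bar_face G [g, h] (Suc (Suc 0)) = [g]"
    by (simp_all add: bar_face_def)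
  have "bar_boundary R G (Suc 1) (single_chain R r [g, h]) hs = r \<otimes> incidence R G (Suc 1) hs [g, h]"
    by (simp add: bar_boundary_eq_lin_ext[OF cl] lin_ext_single_chain[OF r])
  also have "incidence R G (Suc 1) hs [g, h] =
      (if [g] = hs then \<one> else \<zero>) \<oplus> ((if [g \<otimes>\<^bsub>G\<^esub> h] = hs then \<ominus> \<one> else \<zero>) \<oplus> (if [h] = hs then \<one> else \<zero>))"
    unfolding incidence_eq_sum One_nat_def
    by (subst finsum_Suc; (subst finsum_Suc)?) (auto simp: faces sq simp del: nat_pow_Suc)
  also have "r \<otimes> \<dots> = single_chain R r [h] hs \<oplus> (single_chain R (\<ominus> r) [g \<otimes>\<^bsub>G\<^esub> h] hs \<oplus> single_chain R r [g] hs)"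
    using r by (auto simp: single_chain_def r_distr r_minus a_ac)
  finally show "bar_boundary R G (Suc 1) (single_chain R r [g, h]) hs =
    single_chain R r [h] hs \<oplus> (single_chain R (\<ominus> r) [g \<otimes>\<^bsub>G\<^esub> h] hs \<oplus> single_chain R r [g] hs)" .
qed

text \<open>The linear functional on 1-chains with value \<open>\<chi> g\<close> at \<open>[g]\<close>. The case distinction keeps
  all values of the extended function in the ring; chains have no terms outside the carrier of \<open>G\<close>.\<close>

definition eval_chain ::
  "('r, 's) ring_scheme \<Rightarrow> ('a, 'm) monoid_scheme \<Rightarrow> ('a \<Rightarrow> 'r) \<Rightarrow> ('a list \<Rightarrow> 'r) \<Rightarrow> 'r" where
  "eval_chain R G \<chi> = lin_ext R (\<lambda>gs. if hd gs \<in> carrier G then \<chi> (hd gs) else \<zero>\<^bsub>R\<^esub>)"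

text \<open>The kernel of the functional on \<open>H\<^sub>1\<close> that \<open>\<chi>\<close> induces. It is described by representatives, which
  avoids a definition of the functional on cosets.\<close>

definition vanishing_classes ::
  "('r, 's) ring_scheme \<Rightarrow> ('a, 'm) monoid_scheme \<Rightarrow> ('a \<Rightarrow> 'r) \<Rightarrow> ('a list \<Rightarrow> 'r) set set" where
  "vanishing_classes R G \<chi> = (\<lambda>c. bar_boundaries R G 1 +>\<^bsub>bar_chains R G 1\<^esub> c) `
     {c \<in> carrier (bar_chains R G 1). eval_chain R G \<chi> c = \<zero>\<^bsub>R\<^esub>}"

context cring
begin

context
  fixes G :: "('g, 'm) monoid_scheme" and \<chi> :: "'g \<Rightarrow> 'a"
  assumes G: "monoid G"
    and \<chi>_closed: "\<And>x. x \<in> carrier G \<Longrightarrow> \<chi> x \<in> carrier R"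
    and \<chi>_mult: "\<And>x y. \<lbrakk>x \<in> carrier G; y \<in> carrier G\<rbrakk> \<Longrightarrow> \<chi> (x \<otimes>\<^bsub>G\<^esub> y) = \<chi> x \<oplus> \<chi> y"
begin

lemma eval_chain_add:
  "\<lbrakk>c \<in> carrier (bar_chains R G n); d \<in> carrier (bar_chains R G n)\<rbrakk> \<Longrightarrow>
    eval_chain R G \<chi> (\<lambda>gs. c gs \<oplus> d gs) = eval_chain R G \<chi> c \<oplus> eval_chain R G \<chi> d"
  unfolding eval_chain_def by (rule lin_ext_add) (auto simp: carrier_bar_chains \<chi>_closed)

lemma eval_chain_smult:
  "\<lbrakk>c \<in> carrier (bar_chains R G n); r \<in> carrier R\<rbrakk> \<Longrightarrow>
    eval_chain R G \<chi> (\<lambda>gs. r \<otimes> c gs) = r \<otimes> eval_chain R G \<chi> c"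
  unfolding eval_chain_def by (rule lin_ext_smult) (auto simp: carrier_bar_chains \<chi>_closed)

lemma eval_chain_single_chain:
  "\<lbrakk>r \<in> carrier R; g \<in> carrier G\<rbrakk> \<Longrightarrow> eval_chain R G \<chi> (single_chain R r [g]) = r \<otimes> \<chi> g"
  unfolding eval_chain_def by (subst lin_ext_single_chain) (auto simp: \<chi>_closed)

text \<open>The functional induces one on homology: \<open>\<partial>[g|h] = [h] - [gh] + [g]\<close>, and \<open>\<chi>\<close> is a homomorphism.\<close>

lemma eval_chain_boundary:
  assumes "c \<in> carrier (bar_chains R G (Suc 1))"
  shows "eval_chain R G \<chi> (bar_boundary R G (Suc 1) c) = \<zero>"
  using assms
proof (induction rule: bar_chain_induct)
  case zero
  then show ?case
    unfolding bar_boundary_zero by (simp add: eval_chain_def lin_ext_zero)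
next
  case (add c r gs)
  then obtain g h where gs: "gs = [g, h]"
    by (auto simp: length_Suc_conv)
  have gh: "g \<in> carrier G" "h \<in> carrier G" "g \<otimes>\<^bsub>G\<^esub> h \<in> carrier G"
    using add.hyps monoid.m_closed[OF G, of g h] by (auto simp: gs)
  have s: "single_chain R x [y] \<in> carrier (bar_chains R G 1)"
    if "x \<in> carrier R" "y \<in> carrier G" for x y
    using that by (intro single_chain_in_bar_chains) auto
  interpret C: module R "bar_chains R G 1"
    by (rule module_bar_chains)
  have s': "(\<lambda>hs. single_chain R (\<ominus> r) [g \<otimes>\<^bsub>G\<^esub> h] hs \<oplus> single_chain R r [g] hs) \<in> carrier (bar_chains R G 1)"
    using C.M.a_closed[of "single_chain R (\<ominus> r) [g \<otimes>\<^bsub>G\<^esub> h]" "single_chain R r [g]"] s gh add.hyps by simp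
  have "eval_chain R G \<chi> (bar_boundary R G (Suc 1) (single_chain R r gs)) =
      r \<otimes> \<chi> h \<oplus> ((\<ominus> r) \<otimes> \<chi> (g \<otimes>\<^bsub>G\<^esub> h) \<oplus> r \<otimes> \<chi> g)"
    unfolding gs bar_boundary_single_chain_2[OF add.hyps(2)]
    using s s' gh add.hyps by (simp add: eval_chain_add[where n = 1] eval_chain_single_chain)
  also have "\<dots> = \<zero>"
    using gh add.hyps \<chi>_closed by (simp add: \<chi>_mult) algebra
  finally have "eval_chain R G \<chi> (bar_boundary R G (Suc 1) (single_chain R r gs)) = \<zero>" .
  moreover have "single_chain R r gs \<in> carrier (bar_chains R G (Suc 1))"
    using add.hyps by (intro single_chain_in_bar_chains) auto
  ultimately show ?case
    using add bar_boundary_closed[OF G]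
    by (simp only: bar_boundary_add eval_chain_add[where n = 1]) simp
qed

lemma submodule_vanishing_classes:
  "LinearCombinations.submodule R (vanishing_classes R G \<chi>) (group_homology R G 1)"
proof -
  interpret C: module R "bar_chains R G 1"
    by (rule module_bar_chains)
  note N = submodule_bar_boundaries[OF G, of 1]
  note Q = C.module_quotient_module[OF N, folded group_homology_1]
  interpret A: abelian_subgroup "bar_boundaries R G 1" "bar_chains R G 1"
    by (rule C.abelian_subgroup_submodule[OF N])
  show ?thesis
  proof (rule LinearCombinations.submodule.intro[OF Q(1)])
    show "vanishing_classes R G \<chi> \<subseteq> carrier (group_homology R G 1)"
      unfolding group_homology_1 carrier_quotient_module vanishing_classes_def by blast
  next
    fix v w assume "v \<in> vanishing_classes R G \<chi>" "w \<in> vanishing_classes R G \<chi>"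
    then obtain c d where c: "c \<in> carrier (bar_chains R G 1)" "eval_chain R G \<chi> c = \<zero>"
        and d: "d \<in> carrier (bar_chains R G 1)" "eval_chain R G \<chi> d = \<zero>"
        and "v = bar_boundaries R G 1 +>\<^bsub>bar_chains R G 1\<^esub> c"
        and "w = bar_boundaries R G 1 +>\<^bsub>bar_chains R G 1\<^esub> d"
      by (auto simp: vanishing_classes_def)
    then show "v \<oplus>\<^bsub>group_homology R G 1\<^esub> w \<in> vanishing_classes R G \<chi>"
      using Q(3)[of c d] C.M.a_closed[of c d] eval_chain_add[of c 1 d]
      by (auto simp: vanishing_classes_def)
  next
    have "\<zero>\<^bsub>group_homology R G 1\<^esub> = bar_boundaries R G 1 +>\<^bsub>bar_chains R G 1\<^esub> \<zero>\<^bsub>bar_chains R G 1\<^esub>"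
      unfolding group_homology_1
      by (simp only: A.a_rcos_const[OF A.zero_closed]) (simp add: quotient_module_def)
    moreover have "eval_chain R G \<chi> \<zero>\<^bsub>bar_chains R G 1\<^esub> = \<zero>"
      by (simp add: eval_chain_def lin_ext_zero)
    ultimately show "\<zero>\<^bsub>group_homology R G 1\<^esub> \<in> vanishing_classes R G \<chi>"
      using C.M.zero_closed unfolding vanishing_classes_def by blast
  next
    fix r v assume r: "r \<in> carrier R" and "v \<in> vanishing_classes R G \<chi>"
    then obtain c where "c \<in> carrier (bar_chains R G 1)" "eval_chain R G \<chi> c = \<zero>"
        and "v = bar_boundaries R G 1 +>\<^bsub>bar_chains R G 1\<^esub> c"
      by (auto simp: vanishing_classes_def)
    then show "r \<odot>\<^bsub>group_homology R G 1\<^esub> v \<in> vanishing_classes R G \<chi>"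
      using r Q(2)[of r c] C.smult_closed[of r c] eval_chain_smult[of c 1 r]
      by (auto simp: vanishing_classes_def)
  qed
qed

lemma class_in_vanishing_classes_iff:
  assumes c: "c \<in> carrier (bar_chains R G 1)"
  shows "bar_boundaries R G 1 +>\<^bsub>bar_chains R G 1\<^esub> c \<in> vanishing_classes R G \<chi> \<longleftrightarrow> eval_chain R G \<chi> c = \<zero>"
proof
  interpret C: module R "bar_chains R G 1"
    by (rule module_bar_chains)
  interpret A: abelian_subgroup "bar_boundaries R G 1" "bar_chains R G 1"
    by (rule C.abelian_subgroup_submodule[OF submodule_bar_boundaries[OF G]])
  assume "bar_boundaries R G 1 +>\<^bsub>bar_chains R G 1\<^esub> c \<in> vanishing_classes R G \<chi>"
  then obtain d where d: "d \<in> carrier (bar_chains R G 1)" "eval_chain R G \<chi> d = \<zero>"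
    and eq: "bar_boundaries R G 1 +>\<^bsub>bar_chains R G 1\<^esub> d = bar_boundaries R G 1 +>\<^bsub>bar_chains R G 1\<^esub> c"
    by (auto simp: vanishing_classes_def)
  have "c \<in> bar_boundaries R G 1 +>\<^bsub>bar_chains R G 1\<^esub> d"
    using A.a_repr_independenceD[OF c eq] .
  then obtain e where e: "e \<in> carrier (bar_chains R G (Suc 1))"
    and "c = (\<lambda>gs. bar_boundary R G (Suc 1) e gs \<oplus> d gs)"
    by (auto simp: a_r_coset_def r_coset_def bar_boundaries_def)
  then show "eval_chain R G \<chi> c = \<zero>"
    using eval_chain_add[OF bar_boundary_closed[OF G e] d(1)] d(2) eval_chain_boundary[OF e] by simp
qed (use c in \<open>auto simp: vanishing_classes_def\<close>)

end

end

text \<open>Vectors are linearly independent if each lies outside a subspace that contains all the preceding ones.\<close>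

lemma (in vectorspace) vs_dim_ge_if_separated:
  assumes v: "\<And>i. i < k \<Longrightarrow> v i \<in> carrier V"
    and W: "\<And>i. i < k \<Longrightarrow> LinearCombinations.submodule K (W i) V"
    and in_W: "\<And>i j. j < i \<Longrightarrow> i < k \<Longrightarrow> v j \<in> W i"
    and notin_W: "\<And>i. i < k \<Longrightarrow> v i \<notin> W i"
  shows "enat k \<le> vs_dim K V"
proof -
  have "lin_indpt (v ` {..<n}) \<and> card (v ` {..<n}) = n" if "n \<le> k" for n
    using that
  proof (induction n)
    case 0
    then show ?case
      by (simp add: lin_dep_def)
  next
    case (Suc n)
    then have IH: "lin_indpt (v ` {..<n})" "card (v ` {..<n}) = n" and n: "n < k"
      by auto
    have sub: "v ` {..<n} \<subseteq> W n"
      using in_W n by auto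
    then have "span (v ` {..<n}) \<subseteq> W n"
      by (rule span_is_subset[OF _ W[OF n]])
    then have "v n \<notin> span (v ` {..<n})"
      using notin_W[OF n] by blast
    moreover have new: "v n \<notin> v ` {..<n}"
      using sub notin_W[OF n] by blast
    moreover have "v ` {..<n} \<subseteq> carrier V"
      using v n by auto
    ultimately have "lin_indpt (v ` {..<n} \<union> {v n})"
      using lin_dep_iff_in_span[OF _ IH(1) v[OF n]] by blast
    then show ?case
      using new IH(2) by (simp add: lessThan_Suc)
  qed
  from this[of k] have "lin_indpt (v ` {..<k})" "card (v ` {..<k}) = k"
    by auto
  moreover have "v ` {..<k} \<subseteq> carrier V"
    using v by auto
  ultimately have "fin_dim \<Longrightarrow> k \<le> dim"
    using li_le_dim(2)[of "v ` {..<k}"] by simp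
  then show ?thesis
    by (simp add: vs_dim_def)
qed

text \<open>A triangular system of \<open>k\<close> elements and \<open>k\<close> homomorphisms to the field bounds the dimension of
  \<open>H\<^sub>1\<close> from below.\<close>

lemma vs_dim_H1_ge:
  fixes \<chi> :: "nat \<Rightarrow> 'a \<Rightarrow> 'r"
  assumes R: "field R" and G: "monoid G"
    and closed: "\<And>i x. \<lbrakk>i < k; x \<in> carrier G\<rbrakk> \<Longrightarrow> \<chi> i x \<in> carrier R"
    and mult: "\<And>i x y. \<lbrakk>i < k; x \<in> carrier G; y \<in> carrier G\<rbrakk> \<Longrightarrow> \<chi> i (x \<otimes>\<^bsub>G\<^esub> y) = \<chi> i x \<oplus>\<^bsub>R\<^esub> \<chi> i y"
    and g: "\<And>i. i < k \<Longrightarrow> g i \<in> carrier G"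
    and diag: "\<And>i. i < k \<Longrightarrow> \<chi> i (g i) \<noteq> \<zero>\<^bsub>R\<^esub>"
    and triangular: "\<And>i j. \<lbrakk>j < i; i < k\<rbrakk> \<Longrightarrow> \<chi> i (g j) = \<zero>\<^bsub>R\<^esub>"
  shows "enat k \<le> vs_dim R (group_homology R G 1)"
proof -
  interpret R: field R by (rule R)
  interpret C: module R "bar_chains R G 1"
    by (rule R.module_bar_chains)
  have "module R (group_homology R G 1)"
    unfolding R.group_homology_1 by (rule C.module_quotient_module[OF R.submodule_bar_boundaries[OF G]])
  then interpret H: vectorspace R "group_homology R G 1"
    by (rule vectorspace.intro[OF _ R])
  let ?c = "\<lambda>i. single_chain R \<one>\<^bsub>R\<^esub> [g i]"
  let ?v = "\<lambda>i. bar_boundaries R G 1 +>\<^bsub>bar_chains R G 1\<^esub> ?c i"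
  have c: "?c i \<in> carrier (bar_chains R G 1)" if "i < k" for i
    using g[OF that] by (intro R.single_chain_in_bar_chains) auto
  have mem: "?v j \<in> vanishing_classes R G (\<chi> i) \<longleftrightarrow> \<chi> i (g j) = \<zero>\<^bsub>R\<^esub>" if i: "i < k" and j: "j < k" for i j
  proof -
    have "eval_chain R G (\<chi> i) (?c j) = \<one>\<^bsub>R\<^esub> \<otimes>\<^bsub>R\<^esub> \<chi> i (g j)"
      by (rule R.eval_chain_single_chain) (use G closed mult g i j in auto)
    moreover have "?v j \<in> vanishing_classes R G (\<chi> i) \<longleftrightarrow> eval_chain R G (\<chi> i) (?c j) = \<zero>\<^bsub>R\<^esub>"
      by (rule R.class_in_vanishing_classes_iff) (use G closed mult c i j in auto)
    ultimately show ?thesis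
      using closed[OF i g[OF j]] by simp
  qed
  show ?thesis
  proof (rule H.vs_dim_ge_if_separated)
    fix i assume i: "i < k"
    show "?v i \<in> carrier (group_homology R G 1)"
      unfolding R.group_homology_1 carrier_quotient_module using c[OF i] by (rule imageI)
    show "LinearCombinations.submodule R (vanishing_classes R G (\<chi> i)) (group_homology R G 1)"
      using i by (intro R.submodule_vanishing_classes G closed mult)
    show "?v i \<notin> vanishing_classes R G (\<chi> i)"
      using mem[OF i i] diag[OF i] by simp
  next
    fix i j assume "j < i" "i < k"
    then show "?v j \<in> vanishing_classes R G (\<chi> i)"
      using mem[of i j] triangular by simp
  qed
qed

section \<open>Finite affine quotients\<close>

text \<open>Vectors of length \<open>k\<close> over the field with \<open>p\<close> elements are represented as sequences of integers
  with entries in \<open>{0..<p}\<close> that are \<open>0\<close> from the place \<open>k\<close> on; \<open>reduce p k\<close> reduces an arbitrary integer sequence to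
  one of these. Maps are first defined on all integer sequences, where their algebra needs no
  residues. The entry at \<open>i\<close> is the coefficient of \<open>\<epsilon>\<^sup>i\<close>, and \<open>shift\<close> is the multiplication by \<open>\<epsilon>\<close>.\<close>

definition shift :: "(nat \<Rightarrow> int) \<Rightarrow> nat \<Rightarrow> int" where
  "shift v i = (if i = 0 then 0 else v (i - 1))"

text \<open>\<open>1 + \<epsilon> + \<beta> \<epsilon>\<^sup>2\<close>; the values \<open>\<beta> = 0\<close> and \<open>\<beta> = 1\<close> give the actions of \<open>s\<close> and of \<open>t\<close>.\<close>

definition unipotent :: "int \<Rightarrow> (nat \<Rightarrow> int) \<Rightarrow> nat \<Rightarrow> int" where
  "unipotent \<beta> v i = v i + shift v i + \<beta> * shift (shift v) i"

definition reduce :: "nat \<Rightarrow> nat \<Rightarrow> (nat \<Rightarrow> int) \<Rightarrow> nat \<Rightarrow> int" where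
  "reduce p k v i = (if i < k then v i mod int p else 0)"

definition residue_vectors :: "nat \<Rightarrow> nat \<Rightarrow> (nat \<Rightarrow> int) set" where
  "residue_vectors p k = {v. \<forall>i. (i \<in> {..<k} \<longrightarrow> v i \<in> {0..<int p}) \<and> (i \<notin> {..<k} \<longrightarrow> v i = 0)}"

text \<open>The map on reduced vectors that a map on integer sequences induces, and the special case of the
  translation by \<open>c\<close>. They are restricted to \<open>residue_vectors p k\<close> because the elements of \<open>BijGroup\<close> are
  extensional functions.\<close>

definition induced_map :: "nat \<Rightarrow> nat \<Rightarrow> ((nat \<Rightarrow> int) \<Rightarrow> nat \<Rightarrow> int) \<Rightarrow> (nat \<Rightarrow> int) \<Rightarrow> nat \<Rightarrow> int" where
  "induced_map p k M = (\<lambda>v \<in> residue_vectors p k. reduce p k (M v))"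

definition translation :: "nat \<Rightarrow> nat \<Rightarrow> (nat \<Rightarrow> int) \<Rightarrow> (nat \<Rightarrow> int) \<Rightarrow> nat \<Rightarrow> int" where
  "translation p k c = induced_map p k (\<lambda>v i. v i + c i)"

lemma finite_residue_vectors: "finite (residue_vectors p k)"
  unfolding residue_vectors_def by (rule finite_set_of_finite_funs) auto

lemma reduce_id: "v \<in> residue_vectors p k \<Longrightarrow> reduce p k v = v"
  by (auto simp: residue_vectors_def reduce_def fun_eq_iff)

lemma reduce_add: "reduce p k (\<lambda>i. reduce p k v i + w i) = reduce p k (\<lambda>i. v i + w i)"
  "reduce p k (\<lambda>i. w i + reduce p k v i) = reduce p k (\<lambda>i. w i + v i)"
  by (auto simp: reduce_def fun_eq_iff mod_simps)

lemma unipotent_reduce: "reduce p k (unipotent \<beta> (reduce p k v)) = reduce p k (unipotent \<beta> v)"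
  by (auto simp: reduce_def unipotent_def shift_def fun_eq_iff intro!: mod_add_cong mod_mult_cong)

lemma unipotent_add: "unipotent \<beta> (\<lambda>i. v i + w i) = (\<lambda>i. unipotent \<beta> v i + unipotent \<beta> w i)"
  by (auto simp: unipotent_def shift_def fun_eq_iff algebra_simps)

lemma unipotent_commute: "unipotent \<beta> (unipotent \<gamma> v) = unipotent \<gamma> (unipotent \<beta> v)"
  by (auto simp: unipotent_def shift_def fun_eq_iff algebra_simps)

text \<open>The polynomial identity \<open>1 + \<epsilon> + \<epsilon>\<^sup>2 = 1 - x + x\<^sup>2\<close> for \<open>x = 1 + \<epsilon>\<close>, which makes the last of the
  four relations hold.\<close>

lemma unipotent_relation: "unipotent 1 v = (\<lambda>i. v i + - unipotent 0 v i + unipotent 0 (unipotent 0 v) i)"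
  by (auto simp: unipotent_def shift_def fun_eq_iff)

context
  fixes p k :: nat
  assumes p: "p > 0"
begin

lemma reduce_in_residue_vectors: "reduce p k v \<in> residue_vectors p k"
  using p by (auto simp: reduce_def residue_vectors_def)

lemma induced_map_mult:
  assumes "induced_map p k M \<in> Bij (residue_vectors p k)" "induced_map p k M' \<in> Bij (residue_vectors p k)"
    and "\<And>v. reduce p k (M (reduce p k v)) = reduce p k (M v)"
  shows "induced_map p k M \<otimes>\<^bsub>BijGroup (residue_vectors p k)\<^esub> induced_map p k M' = induced_map p k (M \<circ> M')"
  using assms by (auto simp: BijGroup_def induced_map_def compose_def fun_eq_iff reduce_in_residue_vectors)

lemma unipotent_Bij: "induced_map p k (unipotent \<beta>) \<in> Bij (residue_vectors p k)"
proof -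
  \<comment> \<open>The matrix of the map is unitriangular, so the entries of \<open>v\<close> can be recovered from left to right.\<close>
  have "inj_on (\<lambda>v. reduce p k (unipotent \<beta> v)) (residue_vectors p k)"
  proof (rule inj_onI)
    fix v w assume v: "v \<in> residue_vectors p k" and w: "w \<in> residue_vectors p k"
      and eq: "reduce p k (unipotent \<beta> v) = reduce p k (unipotent \<beta> w)"
    have "v i = w i" for i
    proof (induction i rule: less_induct)
      case (less i)
      show ?case
      proof (cases "i < k")
        case True
        have sh: "shift v i = shift w i" "shift (shift v) i = shift (shift w) i"
          using less by (simp_all add: shift_def)
        have "unipotent \<beta> v i mod int p = unipotent \<beta> w i mod int p"
          using fun_cong[OF eq, of i] True by (simp add: reduce_def)
        from mod_diff_cong[OF this refl, of "shift v i + \<beta> * shift (shift v) i"]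
        have "v i mod int p = w i mod int p"
          by (simp add: unipotent_def sh)
        then show ?thesis
          using v w True by (auto simp: residue_vectors_def)
      qed (use v w in \<open>auto simp: residue_vectors_def\<close>)
    qed
    then show "v = w" by auto
  qed
  then have "bij_betw (\<lambda>v. reduce p k (unipotent \<beta> v)) (residue_vectors p k) (residue_vectors p k)"
    using endo_inj_surj[OF finite_residue_vectors, of "\<lambda>v. reduce p k (unipotent \<beta> v)" p k] reduce_in_residue_vectors
    by (auto simp: bij_betw_def)
  then show ?thesis
    by (simp add: Bij_def induced_map_def)
qed

lemma translation_Bij: "translation p k c \<in> Bij (residue_vectors p k)"
proof -
  have inv: "reduce p k (\<lambda>i. reduce p k (\<lambda>i. v i + c i) i - c i) = v"
    "reduce p k (\<lambda>i. reduce p k (\<lambda>i. v i - c i) i + c i) = v" if "v \<in> residue_vectors p k" for v c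
    using reduce_add(1)[of p k "\<lambda>i. v i + c i" "\<lambda>i. - c i"] reduce_add(1)[of p k "\<lambda>i. v i - c i" c]
      reduce_id[OF that] by simp_all
  have "bij_betw (\<lambda>v. reduce p k (\<lambda>i. v i + c i)) (residue_vectors p k) (residue_vectors p k)"
    by (rule bij_betw_byWitness[where f' = "\<lambda>v. reduce p k (\<lambda>i. v i - c i)"])
      (auto simp: inv reduce_in_residue_vectors)
  then show ?thesis
    by (simp add: Bij_def induced_map_def translation_def)
qed

lemma translation_mult:
  "translation p k c \<otimes>\<^bsub>BijGroup (residue_vectors p k)\<^esub> translation p k d = translation p k (\<lambda>i. c i + d i)"
proof -
  have "translation p k c \<otimes>\<^bsub>BijGroup (residue_vectors p k)\<^esub> translation p k d =
      induced_map p k ((\<lambda>v i. v i + c i) \<circ> (\<lambda>v i. v i + d i))"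
    unfolding translation_def
    by (rule induced_map_mult) (use translation_Bij in \<open>auto simp: translation_def reduce_add\<close>)
  also have "\<dots> = translation p k (\<lambda>i. c i + d i)"
    by (simp add: translation_def comp_def add_ac)
  finally show ?thesis .
qed

lemma translation_zero: "translation p k (\<lambda>_. 0) = \<one>\<^bsub>BijGroup (residue_vectors p k)\<^esub>"
  by (auto simp: translation_def induced_map_def BijGroup_def reduce_id)

lemma unipotent_mult:
  "induced_map p k (unipotent \<beta>) \<otimes>\<^bsub>BijGroup (residue_vectors p k)\<^esub> induced_map p k (unipotent \<gamma>) = induced_map p k (unipotent \<beta> \<circ> unipotent \<gamma>)"
  by (rule induced_map_mult) (auto simp: unipotent_Bij unipotent_reduce)

lemma unipotent_mult_commute:
  "induced_map p k (unipotent \<beta>) \<otimes>\<^bsub>BijGroup (residue_vectors p k)\<^esub> induced_map p k (unipotent \<gamma>) =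
   induced_map p k (unipotent \<gamma>) \<otimes>\<^bsub>BijGroup (residue_vectors p k)\<^esub> induced_map p k (unipotent \<beta>)"
  unfolding unipotent_mult by (simp add: comp_def unipotent_commute)

interpretation Bij: group "BijGroup (residue_vectors p k)"
  by (rule group_BijGroup)

lemma translation_carrier [simp]: "translation p k c \<in> carrier (BijGroup (residue_vectors p k))"
  using translation_Bij by (simp add: BijGroup_def)

lemma unipotent_carrier [simp]: "induced_map p k (unipotent \<beta>) \<in> carrier (BijGroup (residue_vectors p k))"
  using unipotent_Bij by (simp add: BijGroup_def)

lemma translation_inv: "inv\<^bsub>BijGroup (residue_vectors p k)\<^esub> translation p k c = translation p k (\<lambda>i. - c i)"
  by (rule Bij.inv_equality) (simp_all add: translation_mult translation_zero)

lemma unipotent_conjugate_translation: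
  "Bij.conjugate (induced_map p k (unipotent \<beta>)) (translation p k c) = translation p k (unipotent \<beta> c)"
proof -
  have "induced_map p k (unipotent \<beta>) \<otimes>\<^bsub>BijGroup (residue_vectors p k)\<^esub> translation p k c = induced_map p k (unipotent \<beta> \<circ> (\<lambda>v i. v i + c i))"
    unfolding translation_def
    by (rule induced_map_mult) (use translation_Bij in \<open>auto simp: translation_def unipotent_Bij unipotent_reduce\<close>)
  also have "\<dots> = induced_map p k ((\<lambda>v i. v i + unipotent \<beta> c i) \<circ> unipotent \<beta>)"
    by (simp add: comp_def unipotent_add)
  also have "\<dots> = translation p k (unipotent \<beta> c) \<otimes>\<^bsub>BijGroup (residue_vectors p k)\<^esub> induced_map p k (unipotent \<beta>)"
    unfolding translation_def
    by (rule induced_map_mult[symmetric]) (use translation_Bij in \<open>auto simp: translation_def unipotent_Bij reduce_add\<close>)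
  finally show ?thesis
    by (simp add: Bij.conjugate_def Bij.m_assoc)
qed

lemma subgroup_translation: "subgroup (range (translation p k)) (BijGroup (residue_vectors p k))"
  by (rule Bij.subgroupI) (auto simp: translation_inv translation_mult)

lemma finite_BijGroup_residue_vectors: "finite (carrier (BijGroup (residue_vectors p k)))"
proof (rule finite_subset)
  show "carrier (BijGroup (residue_vectors p k)) \<subseteq> residue_vectors p k \<rightarrow>\<^sub>E residue_vectors p k"
    by (auto simp: BijGroup_def Bij_def bij_betw_def PiE_def)
qed (simp add: finite_PiE finite_residue_vectors)

lemma translation_at_zero:
  assumes "i < k"
  shows "translation p k c (\<lambda>_. 0) i = c i mod int p"
  using assms p by (auto simp: translation_def induced_map_def residue_vectors_def reduce_def)

end

text \<open>The polynomial \<open>x\<^sup>j = (1 + \<epsilon>)\<^sup>j\<close> is monic of degree \<open>j\<close> in \<open>\<epsilon>\<close>.\<close>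

lemma unipotent_pow_unit:
  "((unipotent 0 ^^ j) (\<lambda>i. if i = 0 then 1 else 0)) j = 1 \<and>
   (\<forall>i > j. ((unipotent 0 ^^ j) (\<lambda>i. if i = 0 then 1 else 0)) i = 0)"
  by (induction j) (auto simp: unipotent_def shift_def)

lemma finite_rcosets_preimage:
  assumes G: "group G" and B: "group B" and \<phi>: "\<phi> \<in> hom G B" and T: "subgroup T B"
    and fin: "finite (carrier B)"
  defines "S \<equiv> {g \<in> carrier G. \<phi> g \<in> T}"
  shows "subgroup S G" "finite (rcosets\<^bsub>G\<^esub> S)"
proof -
  interpret \<phi>: group_hom G B \<phi>
    using G B \<phi> by (simp add: group_hom_def group_hom_axioms_def)
  interpret T: subgroup T B by (rule T)
  show S: "subgroup S G"
    by (rule \<phi>.G.subgroupI) (auto simp: S_def intro!: exI[of _ "\<one>\<^bsub>G\<^esub>"])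
  let ?r = "inv_into (carrier G) \<phi>"
  have "S #>\<^bsub>G\<^esub> g = S #>\<^bsub>G\<^esub> ?r (\<phi> g)" if g: "g \<in> carrier G" for g
  proof (rule \<phi>.G.repr_independence[OF _ _ S])
    have r: "?r (\<phi> g) \<in> carrier G" "\<phi> (?r (\<phi> g)) = \<phi> g"
      using g by (auto intro: inv_into_into f_inv_into_f)
    then have "?r (\<phi> g) \<otimes>\<^bsub>G\<^esub> inv\<^bsub>G\<^esub> g \<in> S"
      using g by (simp add: S_def)
    then show "?r (\<phi> g) \<in> S #>\<^bsub>G\<^esub> g"
      using g r by (auto simp: r_coset_def \<phi>.G.m_assoc intro!: bexI[of _ "?r (\<phi> g) \<otimes>\<^bsub>G\<^esub> inv\<^bsub>G\<^esub> g"])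
  qed (use g in auto)
  then have "rcosets\<^bsub>G\<^esub> S \<subseteq> (\<lambda>b. S #>\<^bsub>G\<^esub> ?r b) ` carrier B"
    by (auto simp: RCOSETS_def)
  then show "finite (rcosets\<^bsub>G\<^esub> S)"
    using fin by (auto intro: finite_subset)
qed

lemma virtual_betti1_baumslag_group_ge:
  fixes p k :: nat
  assumes p: "prime p"
  shows "enat k \<le> virtual_betti1 p baumslag_group"
proof -
  let ?B = "BijGroup (residue_vectors p k)"
  let ?e = "\<lambda>i::nat. if i = 0 then 1 else 0 :: int"
  let ?a = "translation p k ?e" and ?s = "induced_map p k (unipotent 0)" and ?t = "induced_map p k (unipotent 1)"
  interpret Res: residues_prime p "prime_field p"
    using p by (simp add: residues_prime_def)
  have p0: "p > 0" and p1: "int p > 1"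
    using p prime_gt_1_nat[of p] by auto
  interpret B: group ?B
    by (rule group_BijGroup)
  note T = translation_carrier[OF p0] unipotent_carrier[OF p0]
  have ss: "B.conjugate (?s \<otimes>\<^bsub>?B\<^esub> ?s) ?a = translation p k (unipotent 0 (unipotent 0 ?e))"
    using T by (simp add: B.conjugate_conjugate[symmetric] unipotent_conjugate_translation[OF p0])
  have "baumslag_relations ?B ?a ?s ?t \<subseteq> Id"
    unfolding baumslag_relations_def ss unipotent_conjugate_translation[OF p0]
    using unipotent_mult_commute[OF p0, where \<beta> = 0 and \<gamma> = 1]
    by (simp add: translation_mult[OF p0] translation_inv[OF p0] unipotent_relation[of ?e] add.commute)
  then obtain \<phi> where hom: "\<phi> \<in> hom baumslag_group ?B"
    and vals: "\<phi> bg_a = ?a" "\<phi> bg_s = ?s" "\<phi> bg_t = ?t"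
    using hom_from_baumslag_group[OF B.group_axioms] T by metis
  interpret \<phi>: group_hom baumslag_group ?B \<phi>
    using hom by (simp add: group_hom_def group_hom_axioms_def group_baumslag_group B.group_axioms)
  \<comment> \<open>the elements that act as translations\<close>
  define S where "S = {g \<in> carrier baumslag_group. \<phi> g \<in> range (translation p k)}"
  have S: "subgroup S baumslag_group" "finite (rcosets\<^bsub>baumslag_group\<^esub> S)"
    unfolding S_def
    by (rule finite_rcosets_preimage[OF group_baumslag_group B.group_axioms hom
          subgroup_translation[OF p0] finite_BijGroup_residue_vectors[OF p0]])+
  interpret S: group "baumslag_group\<lparr>carrier := S\<rparr>"
    using subgroup.subgroup_is_group[OF S(1) group_baumslag_group] .
  \<comment> \<open>the conjugate \<open>b j\<close> of \<open>a\<close>, which translates by \<open>x\<^sup>j\<close>\<close>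
  define g where "g j = (group.conjugate baumslag_group bg_s ^^ j) bg_a" for j :: nat
  have g: "g j \<in> carrier baumslag_group \<and> \<phi> (g j) = translation p k ((unipotent 0 ^^ j) ?e)" for j
  proof (induction j)
    case 0
    show ?case
      using bg_closed(1) vals(1) by (simp add: g_def)
  next
    case (Suc j)
    have "g (Suc j) = group.conjugate baumslag_group bg_s (g j)"
      by (simp add: g_def)
    then show ?case
      using Suc bg_closed(2) vals(2) \<phi>.hom_conjugate[of bg_s "g j"]
        group.conjugate_closed[OF group_baumslag_group, of bg_s "g j"]
      by (simp add: unipotent_conjugate_translation[OF p0])
  qed
  \<comment> \<open>A translation vector is the image of the zero vector; \<open>\<chi> i\<close> is its coordinate at \<open>i\<close>.\<close>
  define \<chi> where "\<chi> i x = \<phi> x (\<lambda>_. 0) i" for i :: nat and x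
  have \<chi>: "\<chi> i x = c i mod int p" if "i < k" "\<phi> x = translation p k c" for i x c
    using that by (simp add: \<chi>_def translation_at_zero[OF p0])
  have "enat k \<le> vs_dim (prime_field p) (group_homology (prime_field p) (baumslag_group\<lparr>carrier := S\<rparr>) 1)"
  proof (rule vs_dim_H1_ge)
    show "field (prime_field p)"
      by (rule Res.is_field)
    show "monoid (baumslag_group\<lparr>carrier := S\<rparr>)"
      by (rule S.is_monoid)
  next
    fix i x assume i: "i < k" and "x \<in> carrier (baumslag_group\<lparr>carrier := S\<rparr>)"
    then obtain c where "\<phi> x = translation p k c"
      by (auto simp: S_def)
    then show "\<chi> i x \<in> carrier (prime_field p)"
      using \<chi>[OF i] p0 by (simp add: residue_ring_def)
  next
    fix i x y assume i: "i < k"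
      and x: "x \<in> carrier (baumslag_group\<lparr>carrier := S\<rparr>)" and y: "y \<in> carrier (baumslag_group\<lparr>carrier := S\<rparr>)"
    then obtain c d where cd: "\<phi> x = translation p k c" "\<phi> y = translation p k d"
      by (auto simp: S_def)
    then have "\<phi> (x \<otimes>\<^bsub>baumslag_group\<^esub> y) = translation p k (\<lambda>i. c i + d i)"
      using x y by (simp add: S_def translation_mult[OF p0])
    then show "\<chi> i (x \<otimes>\<^bsub>baumslag_group\<lparr>carrier := S\<rparr>\<^esub> y) = \<chi> i x \<oplus>\<^bsub>prime_field p\<^esub> \<chi> i y"
      using \<chi>[OF i] cd by (simp add: residue_ring_def mod_simps)
  next
    fix i assume i: "i < k"
    show "g i \<in> carrier (baumslag_group\<lparr>carrier := S\<rparr>)"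
      using g[of i] by (auto simp: S_def)
    show "\<chi> i (g i) \<noteq> \<zero>\<^bsub>prime_field p\<^esub>"
      using \<chi>[OF i] g[of i] unipotent_pow_unit[of i] p1 by (simp add: residue_ring_def)
  next
    fix i j assume "j < i" "i < k"
    then show "\<chi> i (g j) = \<zero>\<^bsub>prime_field p\<^esub>"
      using \<chi>[of i] g[of j] unipotent_pow_unit[of j] by (simp add: residue_ring_def)
  qed
  then show ?thesis
    unfolding virtual_betti1_def using S by (intro SUP_upper2[of S]) auto
qed

theorem proposition5p1:
  fixes p :: nat
  assumes "prime p"
  shows "\<exists>\<Gamma> :: nat monoid. finitely_presented \<Gamma> \<and> metabelian \<Gamma> \<and> virtual_betti1 p \<Gamma> = \<infinity>"
proof (intro exI conjI)
  show "finitely_presented baumslag_group"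
    by (rule finitely_presented_baumslag_group)
  interpret baumslag_generators baumslag_group bg_a bg_s bg_t
    using group_baumslag_group bg_closed generate_baumslag_group baumslag_relations_generators
    by (simp add: baumslag_generators_def baumslag_generators_axioms_def)
  show "metabelian baumslag_group"
    by (rule metabelian_G)
  have "enat k \<le> virtual_betti1 p baumslag_group" for k
    by (rule virtual_betti1_baumslag_group_ge[OF assms])
  then show "virtual_betti1 p baumslag_group = \<infinity>"
    by (metis enat_ord_simps(1) not_infinity_eq Suc_n_not_le_n)
qed

end
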